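(* Let $\tau\in\mathbb{H}$ and let $D$ be a principal divisor on $E_\tau=\mathbb{C}/L_\tau$, with $m_0$ the multiplicity of $O$ in $D$. Take a principal lift $\tilde D=\sum_\alpha m_\alpha(\alpha)$ of $D$ in which every $\alpha$ lying in $L_\tau$ equals $0$. Then $\frac{df_D}{f_D}=\sum_\alpha m_\alpha\zeta(z-\alpha)\,dz=\sum_{\omega\in L_\tau}\Bigl[\sum_\alpha\frac{m_\alpha}{z-\alpha-\omega}\Bigr]dz,$ where the outer sum over $\omega$ converges absolutely. Furthermore, if $D$ is supported on $E_\tau[\ell]$ for some $\ell\ge1$, then the Laurent expansion of $df_D/f_D$ at $z=0$ is $\frac{df_D}{f_D}=\Bigl(\frac{m_0}{z}-\sum_{j\ge1}E_j(\tau,D)z^{j-1}\Bigr)dz.$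
   Context: $L_\tau=\mathbb{Z}+\mathbb{Z}\tau$; $\zeta(z)=\frac1z+\sum_{0\ne\omega\in L_\tau}\bigl(\frac1{z-\omega}+\frac1\omega+\frac z{\omega^2}\bigr)$ is the Weierstrass zeta function. $O$ is the image of $0$ in $E_\tau=\mathbb{C}/L_\tau$. A divisor $D=\sum m_\alpha(P_\alpha)$ on $E_\tau$ is principal iff $\sum m_\alpha=0$ and $\sum m_\alpha\alpha\in L_\tau$; a principal lift is a formal sum $\tilde D=\sum_\alpha m_\alpha(\alpha)$ of points of $\mathbb{C}$ mapping to $D$ with $\sum m_\alpha=0$ and $\sum m_\alpha\alpha=0$ in $\mathbb{C}$. $f_D$ denotes the elliptic function (for $L_\tau$) with divisor $D$ normalized so that $f_D=z^{m_0}(1+O(z))$ near $z=0$. For $\alpha\in\frac1\ell L_\tau$ and $j\ge1$, $E_j(\tau,\alpha)$ is the value at $s=0$ of the analytic continuation of $\sum'_{\omega\in L_\tau}(\alpha+\omega)^{-j}|\alpha+\omega|^{-2s}$ (omitting $\omega=-\alpha$ if $\alpha\in L_\tau$; convergent for $\operatorname{Re}s>1-j/2$); for $D$ supported on $E_\tau[\ell]$ with any lift $\sum m_\alpha(\alpha)$, $E_j(\tau,D)=\sum m_\alpha E_j(\tau,\alpha)$. *)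

theory Defs
  imports
    "HOL-Complex_Analysis.Complex_Analysis"
    "HOL-Library.Poly_Mapping"
    "HOL-Library.Landau_Symbols"
begin

definition period_lattice :: "complex \<Rightarrow> complex set" where
  "period_lattice \<tau> = {of_int a + of_int b * \<tau> | a b. True}"

definition weierstrass_zeta :: "complex \<Rightarrow> complex \<Rightarrow> complex" where
  "weierstrass_zeta \<tau> z =
     1 / z + (\<Sum>\<^sub>\<infinity>\<omega>\<in>period_lattice \<tau> - {0}. 1 / (z - \<omega>) + 1 / \<omega> + z / \<omega>\<^sup>2)"

definition lattice_rel :: "complex \<Rightarrow> (complex \<times> complex) set" where
  "lattice_rel \<tau> = {(z, w). z - w \<in> period_lattice \<tau>}"

definition torus :: "complex \<Rightarrow> complex set set" where
  "torus \<tau> = UNIV // lattice_rel \<tau>"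

definition to_torus :: "complex \<Rightarrow> complex \<Rightarrow> complex set" where
  "to_torus \<tau> z = lattice_rel \<tau> `` {z}"

definition torus_torsion :: "complex \<Rightarrow> nat \<Rightarrow> complex set set" where
  "torus_torsion \<tau> l = to_torus \<tau> ` {z. of_nat l * z \<in> period_lattice \<tau>}"

text \<open>
  Formal sums are finitely supported integer-valued functions: a divisor on the torus is a
  formal sum of cosets, a lift is a formal sum of complex numbers.
\<close>

definition is_divisor :: "complex \<Rightarrow> (complex set \<Rightarrow>\<^sub>0 int) \<Rightarrow> bool" where
  "is_divisor \<tau> D \<longleftrightarrow> Poly_Mapping.keys D \<subseteq> torus \<tau>"

text \<open>The pushforward of \<open>m\<close> along the projection to the torus is \<open>D\<close>; several points
  of \<open>m\<close> may lie over the same point of the torus.\<close>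

definition is_lift :: "complex \<Rightarrow> (complex set \<Rightarrow>\<^sub>0 int) \<Rightarrow> (complex \<Rightarrow>\<^sub>0 int) \<Rightarrow> bool" where
  "is_lift \<tau> D m \<longleftrightarrow>
     (\<forall>P. Poly_Mapping.lookup D P =
        (\<Sum>\<alpha> | \<alpha> \<in> Poly_Mapping.keys m \<and> to_torus \<tau> \<alpha> = P. Poly_Mapping.lookup m \<alpha>))"

definition lift_degree :: "(complex \<Rightarrow>\<^sub>0 int) \<Rightarrow> int" where
  "lift_degree m = (\<Sum>\<alpha>\<in>Poly_Mapping.keys m. Poly_Mapping.lookup m \<alpha>)"

definition lift_sum :: "(complex \<Rightarrow>\<^sub>0 int) \<Rightarrow> complex" where
  "lift_sum m = (\<Sum>\<alpha>\<in>Poly_Mapping.keys m. of_int (Poly_Mapping.lookup m \<alpha>) * \<alpha>)"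

text \<open>The degree of a lift, and its sum modulo the lattice, depend only on \<open>D\<close>.\<close>

definition principal_divisor :: "complex \<Rightarrow> (complex set \<Rightarrow>\<^sub>0 int) \<Rightarrow> bool" where
  "principal_divisor \<tau> D \<longleftrightarrow>
     is_divisor \<tau> D \<and> (\<exists>m. is_lift \<tau> D m \<and> lift_degree m = 0 \<and> lift_sum m \<in> period_lattice \<tau>)"

definition principal_lift :: "complex \<Rightarrow> (complex set \<Rightarrow>\<^sub>0 int) \<Rightarrow> (complex \<Rightarrow>\<^sub>0 int) \<Rightarrow> bool" where
  "principal_lift \<tau> D m \<longleftrightarrow> is_lift \<tau> D m \<and> lift_degree m = 0 \<and> lift_sum m = 0"

definition mult_at_origin :: "complex \<Rightarrow> (complex set \<Rightarrow>\<^sub>0 int) \<Rightarrow> int" where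
  "mult_at_origin \<tau> D = Poly_Mapping.lookup D (to_torus \<tau> 0)"

text \<open>Being nicely meromorphic fixes the values of the total function \<open>f\<close> at its poles, so
  that distinct functions represent distinct elliptic functions.\<close>

definition elliptic_fun :: "complex \<Rightarrow> (complex \<Rightarrow> complex) \<Rightarrow> bool" where
  "elliptic_fun \<tau> f \<longleftrightarrow>
     f nicely_meromorphic_on UNIV \<and> (\<forall>z. \<forall>\<omega>\<in>period_lattice \<tau>. f (z + \<omega>) = f z)"

definition has_divisor :: "complex \<Rightarrow> (complex \<Rightarrow> complex) \<Rightarrow> (complex set \<Rightarrow>\<^sub>0 int) \<Rightarrow> bool" where
  "has_divisor \<tau> f D \<longleftrightarrow>
     (\<exists>z. f z \<noteq> 0) \<and> is_divisor \<tau> D \<and> (\<forall>z. zorder f z = Poly_Mapping.lookup D (to_torus \<tau> z))"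

definition elliptic_fun_of_divisor :: "complex \<Rightarrow> (complex set \<Rightarrow>\<^sub>0 int) \<Rightarrow> complex \<Rightarrow> complex" where
  "elliptic_fun_of_divisor \<tau> D =
     (THE f. elliptic_fun \<tau> f \<and> has_divisor \<tau> f D \<and>
        (\<lambda>z. f z / z powi mult_at_origin \<tau> D - 1) \<in> O[at 0](\<lambda>z. z))"

definition eisenstein_series :: "complex \<Rightarrow> nat \<Rightarrow> complex \<Rightarrow> complex \<Rightarrow> complex" where
  "eisenstein_series \<tau> j \<alpha> s =
     (\<Sum>\<^sub>\<infinity>\<omega>\<in>period_lattice \<tau> - {-\<alpha>}.
        1 / (\<alpha> + \<omega>) ^ j * of_real (cmod (\<alpha> + \<omega>)) powr (- 2 * s))"

text \<open>The value at \<open>s = 0\<close> of the analytic continuation of the series from its half-plane of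
  convergence to a half-plane containing \<open>0\<close>; by the identity theorem it depends neither on
  the half-plane nor on the continuation \<open>F\<close>.\<close>

definition eisenstein_E :: "nat \<Rightarrow> complex \<Rightarrow> complex \<Rightarrow> complex" where
  "eisenstein_E j \<tau> \<alpha> =
     (THE v. \<exists>F c. c < 0 \<and> F holomorphic_on {s. c < Re s} \<and>
        (\<forall>s. 1 - real j / 2 < Re s \<longrightarrow> F s = eisenstein_series \<tau> j \<alpha> s) \<and> v = F 0)"

text \<open>The lift used here has one representative over each point of the support. The choice is
  immaterial because \<open>eisenstein_E j \<tau> \<alpha>\<close> depends only on the class of \<open>\<alpha>\<close>.\<close>

definition eisenstein_E_divisor :: "nat \<Rightarrow> complex \<Rightarrow> (complex set \<Rightarrow>\<^sub>0 int) \<Rightarrow> complex" where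
  "eisenstein_E_divisor j \<tau> D =
     (\<Sum>P\<in>Poly_Mapping.keys D. of_int (Poly_Mapping.lookup D P) * eisenstein_E j \<tau> (SOME \<alpha>. \<alpha> \<in> P))"

end

theory Submission
  imports Defs
begin

text \<open>
  If \<open>\<Sum>m\<^sub>\<alpha> = 0\<close> and \<open>\<Sum>m\<^sub>\<alpha> \<alpha> = 0\<close>, then \<open>\<Sum>m\<^sub>\<alpha> \<phi>(\<alpha> + \<omega>)\<close> is a second order difference of
  \<open>\<phi>(z) = z\<^bsup>-j\<^esup> |z|\<^bsup>-2s\<^esup>\<close>, so it is smaller than \<open>\<phi>(\<omega>)\<close> by a factor of order \<open>|\<omega>|\<^bsup>-2\<^esup>\<close> and its sum
  over the lattice is holomorphic in \<open>Re s > -j/2\<close>. By the identity theorem its value at \<open>s = 0\<close> is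
  \<open>\<Sum>m\<^sub>\<alpha> E\<^sub>j(\<alpha>)\<close>. For \<open>j = 1\<close> this value is also \<open>\<Sum>m\<^sub>\<alpha> \<zeta>(\<alpha>)\<close>, so the periodicity of \<open>E\<^sub>1\<close> gives the
  quasi-periodicity of \<open>\<zeta>\<close> and hence of \<open>\<sigma>\<close>. The function \<open>f\<^sub>D\<close> is then a multiple of
  \<open>\<Prod>\<sigma>(z - \<alpha>)\<^bsup>m\<^sub>\<alpha>\<^esup>\<close>, unique by Liouville's theorem, and expanding the lattice sum of
  \<open>\<Sum>m\<^sub>\<alpha> / (z - \<alpha> - \<omega>)\<close> term by term gives the Laurent coefficients.
\<close>

section \<open>Period lattices\<close>

text \<open>Balanced sums continue to \<open>s = 0\<close> by themselves, but
  \<open>eisenstein_E\<close> is a definite description at a single \<alpha>: it is accessible only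
  after a continuation of one unbalanced series has been exhibited, and for \<open>j = 1, 2\<close>
  that series does not converge absolutely at \<open>s = 0\<close>. Instead of Poisson summation,
  differences of lattice translates, which sum to zero, are added to each term until it decays two
  powers faster (\<open>eis_reg\<close>). The vector field behind these differences matters. The
  radial field \<open>z\<close> satisfies \<open>div (z \<phi>) = (2 - j - 2 s) \<phi>\<close>, and
  this factor vanishes at \<open>s = 1 - j/2\<close>, which is \<open>s = 0\<close> for
  \<open>j = 2\<close>. The rotation field \<open>\<i> z\<close> has no divergence and preserves
  \<open>|z|\<close>; its factor \<open>-\<i> j\<close> is free of \<open>s\<close> and nonzero for
  \<open>j \<ge> 1\<close>. A second obstacle: \<phi> is not holomorphic in \<open>z\<close>. Its
  differences are estimated along real lines continued to a complex parameter, where Cauchy's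
  estimates apply. The first order term then involves \<open>cnj \<alpha>\<close> too, so
  \<open>\<Sum>m\<^sub>\<alpha> cnj \<alpha> = 0\<close> is required; it follows by conjugation
  because the multiplicities are integers.\<close>

lemma period_latticeI: "of_int a + of_int b * \<tau> \<in> period_lattice \<tau>"
  by (auto simp: period_lattice_def)

lemma zero_in_period_lattice [simp]: "0 \<in> period_lattice \<tau>"
  using period_latticeI[of 0 0 \<tau>] by simp

lemma one_in_period_lattice [simp]: "1 \<in> period_lattice \<tau>"
  using period_latticeI[of 1 0 \<tau>] by simp

lemma self_in_period_lattice [simp]: "\<tau> \<in> period_lattice \<tau>"
  using period_latticeI[of 0 1 \<tau>] by simp

lemma period_lattice_add: "x \<in> period_lattice \<tau> \<Longrightarrow> y \<in> period_lattice \<tau> \<Longrightarrow> x + y \<in> period_lattice \<tau>"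
proof -
  assume "x \<in> period_lattice \<tau>" "y \<in> period_lattice \<tau>"
  then obtain a b c d :: int where "x = of_int a + of_int b * \<tau>" "y = of_int c + of_int d * \<tau>"
    by (auto simp: period_lattice_def)
  hence "x + y = of_int (a + c) + of_int (b + d) * \<tau>"
    by (simp add: algebra_simps)
  thus ?thesis using period_latticeI by metis
qed

lemma period_lattice_uminus: "x \<in> period_lattice \<tau> \<Longrightarrow> - x \<in> period_lattice \<tau>"
proof -
  assume "x \<in> period_lattice \<tau>"
  then obtain a b :: int where "x = of_int a + of_int b * \<tau>"
    by (auto simp: period_lattice_def)
  hence "- x = of_int (- a) + of_int (- b) * \<tau>"
    by (simp add: algebra_simps)
  thus ?thesis using period_latticeI by metis
qed

lemma period_lattice_diff: "x \<in> period_lattice \<tau> \<Longrightarrow> y \<in> period_lattice \<tau> \<Longrightarrow> x - y \<in> period_lattice \<tau>"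
  using period_lattice_add[of x \<tau> "-y"] period_lattice_uminus[of y \<tau>] by simp

lemma period_lattice_uminus_iff [simp]: "- x \<in> period_lattice \<tau> \<longleftrightarrow> x \<in> period_lattice \<tau>"
  using period_lattice_uminus[of x \<tau>] period_lattice_uminus[of "-x" \<tau>] by auto

lemma period_lattice_minus_commute: "x - y \<in> period_lattice \<tau> \<longleftrightarrow> y - x \<in> period_lattice \<tau>"
  using period_lattice_uminus_iff[of "x - y" \<tau>] by simp

lemma period_lattice_add_iff [simp]:
  assumes "y \<in> period_lattice \<tau>"
  shows "x + y \<in> period_lattice \<tau> \<longleftrightarrow> x \<in> period_lattice \<tau>"
    and "y + x \<in> period_lattice \<tau> \<longleftrightarrow> x \<in> period_lattice \<tau>"
    and "x - y \<in> period_lattice \<tau> \<longleftrightarrow> x \<in> period_lattice \<tau>"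
proof -
  show *: "x + y \<in> period_lattice \<tau> \<longleftrightarrow> x \<in> period_lattice \<tau>"
    using period_lattice_add[OF _ assms, of x] period_lattice_diff[OF _ assms, of "x + y"] by auto
  thus "y + x \<in> period_lattice \<tau> \<longleftrightarrow> x \<in> period_lattice \<tau>"
    by (subst add.commute)
  show "x - y \<in> period_lattice \<tau> \<longleftrightarrow> x \<in> period_lattice \<tau>"
    using period_lattice_diff[OF _ assms, of x] period_lattice_add[OF _ assms, of "x - y"] by auto
qed

lemma bij_betw_period_lattice_shift:
  assumes "\<omega>0 \<in> period_lattice \<tau>"
  shows "bij_betw (\<lambda>\<omega>. \<omega> + \<omega>0) (period_lattice \<tau>) (period_lattice \<tau>)"
  by (rule bij_betw_byWitness[of _ "\<lambda>\<omega>. \<omega> - \<omega>0"]) (use assms in auto)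

lemma infsum_period_lattice_shift:
  assumes "\<omega>0 \<in> period_lattice \<tau>"
  shows "infsum (\<lambda>\<omega>. f (\<omega> + \<omega>0)) (period_lattice \<tau>) = infsum f (period_lattice \<tau>)"
  by (rule infsum_reindex_bij_betw[OF bij_betw_period_lattice_shift[OF assms]])

lemma infsum_period_lattice_uminus:
  "infsum (\<lambda>\<omega>. f (- \<omega>)) (period_lattice \<tau>) = infsum f (period_lattice \<tau>)"
  by (rule infsum_reindex_bij_betw, rule bij_betw_byWitness[of _ uminus]) auto

lemma summable_on_period_lattice_uminus:
  "(\<lambda>\<omega>. f (- \<omega>)) summable_on period_lattice \<tau> \<longleftrightarrow> f summable_on period_lattice \<tau>"
  by (rule summable_on_reindex_bij_betw, rule bij_betw_byWitness[of _ uminus]) auto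

lemma period_lattice_norm_lower_bound:
  assumes "Im \<tau> > 0"
  obtains c where "c > 0" "\<And>a b. c * (\<bar>of_int a\<bar> + \<bar>of_int b\<bar>) \<le> cmod (of_int a + of_int b * \<tau>)"
proof -
  \<comment> \<open>The imaginary part bounds \<open>b\<close> by \<open>cmod z / Im \<tau>\<close>,
    and the real part then bounds \<open>a\<close>; \<open>C\<close> collects the two
    bounds.\<close>
  define C where "C = 1 + (1 + \<bar>Re \<tau>\<bar>) / Im \<tau>"
  have C: "C > 0" using assms by (auto simp: C_def intro!: add_pos_nonneg)
  have "\<bar>of_int a\<bar> + \<bar>of_int b\<bar> \<le> C * cmod (of_int a + of_int b * \<tau>)" for a b :: int
  proof -
    define z where "z = of_int a + of_int b * \<tau>"
    have "\<bar>of_int b\<bar> * Im \<tau> = \<bar>Im z\<bar>" using assms by (simp add: z_def abs_mult)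
    also have "\<dots> \<le> cmod z" by (rule abs_Im_le_cmod)
    finally have b: "\<bar>of_int b\<bar> \<le> cmod z / Im \<tau>" using assms by (simp add: field_simps)
    have "of_int a = Re z - of_int b * Re \<tau>" by (simp add: z_def)
    hence "\<bar>of_int a\<bar> \<le> \<bar>Re z\<bar> + \<bar>of_int b\<bar> * \<bar>Re \<tau>\<bar>"
      by (metis abs_mult abs_triangle_ineq4)
    also have "\<dots> \<le> cmod z + cmod z / Im \<tau> * \<bar>Re \<tau>\<bar>"
      by (intro add_mono mult_right_mono b abs_Re_le_cmod) auto
    finally have "\<bar>of_int a\<bar> + \<bar>of_int b\<bar> \<le> cmod z + cmod z / Im \<tau> * \<bar>Re \<tau>\<bar> + cmod z / Im \<tau>"
      using b by linarith
    also have "\<dots> = C * cmod z" using assms by (simp add: C_def field_simps)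
    finally show ?thesis by (simp add: z_def)
  qed
  hence "1 / C * (\<bar>of_int a\<bar> + \<bar>of_int b\<bar>) \<le> cmod (of_int a + of_int b * \<tau>)" for a b :: int
    using C by (simp add: field_simps)
  thus ?thesis using that[of "1 / C"] C by simp
qed

lemma finite_period_lattice_ball:
  assumes "Im \<tau> > 0"
  shows "finite {\<omega> \<in> period_lattice \<tau>. cmod \<omega> \<le> R}"
proof -
  obtain c where c: "c > 0" "\<And>a b. c * (\<bar>of_int a\<bar> + \<bar>of_int b\<bar>) \<le> cmod (of_int a + of_int b * \<tau>)"
    using period_lattice_norm_lower_bound[OF assms] by blast
  define N where "N = \<lceil>R / c\<rceil>"
  have "{\<omega> \<in> period_lattice \<tau>. cmod \<omega> \<le> R} \<subseteq> (\<lambda>(a, b). of_int a + of_int b * \<tau>) ` ({-N..N} \<times> {-N..N})"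
  proof
    fix \<omega> assume "\<omega> \<in> {\<omega> \<in> period_lattice \<tau>. cmod \<omega> \<le> R}"
    then obtain a b :: int where w: "\<omega> = of_int a + of_int b * \<tau>" "cmod \<omega> \<le> R"
      by (auto simp: period_lattice_def)
    have "c * (\<bar>of_int a\<bar> + \<bar>of_int b\<bar>) \<le> R" using c(2)[of a b] w by simp
    hence "\<bar>of_int a\<bar> + \<bar>of_int b\<bar> \<le> R / c" using c(1) by (simp add: field_simps)
    also have "\<dots> \<le> of_int N" by (simp add: N_def)
    finally have "\<bar>a\<bar> + \<bar>b\<bar> \<le> N" by linarith
    hence "a \<in> {-N..N}" "b \<in> {-N..N}" by auto
    thus "\<omega> \<in> (\<lambda>(a, b). of_int a + of_int b * \<tau>) ` ({-N..N} \<times> {-N..N})" using w(1) by auto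
  qed
  thus ?thesis by (rule finite_subset) auto
qed

lemma summable_on_int_powr:
  fixes r :: real
  assumes "r > 1"
  shows "(\<lambda>a::int. (1 + \<bar>of_int a\<bar>) powr - r) summable_on UNIV"
proof -
  have "summable (\<lambda>n. of_nat n powr - r)"
    using assms by (subst summable_real_powr_iff) auto
  hence "summable (\<lambda>n. of_nat (Suc n) powr - r)" by (subst summable_Suc_iff)
  hence nat: "(\<lambda>n. (1 + real n) powr - r) summable_on UNIV"
    by (subst summable_on_UNIV_nonneg_real_iff) auto
  have "(\<lambda>a::int. (1 + \<bar>of_int a\<bar>) powr - r) summable_on range int"
    using nat by (subst summable_on_reindex) (auto simp: o_def)
  moreover have "(\<lambda>a::int. (1 + \<bar>of_int a\<bar>) powr - r) summable_on range (\<lambda>n. - int n)"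
    using nat by (subst summable_on_reindex) (auto simp: o_def inj_on_def)
  ultimately have "(\<lambda>a::int. (1 + \<bar>of_int a\<bar>) powr - r) summable_on (range int \<union> range (\<lambda>n. - int n))"
    by (rule summable_on_union)
  also have "range int \<union> range (\<lambda>n. - int n) = UNIV"
    by (auto simp: image_iff) (metis int_cases2)
  finally show ?thesis .
qed

text \<open>The double sum is compared with a product of two one-dimensional series:
  \<open>2 (|a| + |b|)\<close> dominates the square root of \<open>(1 + |a|) (1 + |b|)\<close>, so
  each factor carries the exponent \<open>r / 2 > 1\<close>.\<close>

lemma summable_on_period_lattice_powr:
  assumes "Im \<tau> > 0" "r > 2"
  shows "(\<lambda>\<omega>. cmod \<omega> powr - r) summable_on period_lattice \<tau>"
proof -
  obtain c where c: "c > 0" "\<And>a b. c * (\<bar>of_int a\<bar> + \<bar>of_int b\<bar>) \<le> cmod (of_int a + of_int b * \<tau>)"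
    using period_lattice_norm_lower_bound[OF assms(1)] by blast
  define g where "g = (\<lambda>a::int. (1 + \<bar>of_int a\<bar>) powr - (r / 2))"
  define w where "w = (\<lambda>(a::int, b::int). of_int a + of_int b * \<tau>)"
  have g: "g summable_on UNIV"
    unfolding g_def by (rule summable_on_int_powr) (use assms in auto)
  have "(\<lambda>(a, b). g a * g b) summable_on (UNIV \<times> UNIV)"
    by (rule summable_on_SigmaI[where g = "\<lambda>a. g a * infsum g UNIV"])
       (use g in \<open>auto intro!: has_sum_cmult_right has_sum_infsum summable_on_cmult_left simp: g_def\<close>)
  hence sum2: "(\<lambda>x. (c / 2) powr - r * (case x of (a, b) \<Rightarrow> g a * g b)) summable_on UNIV"
    by (intro summable_on_cmult_right) auto
  have "(\<lambda>x. cmod (w x) powr - r) summable_on UNIV"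
  proof (rule summable_on_comparison_test[OF sum2])
    fix x :: "int \<times> int"
    obtain a b where x: "x = (a, b)" by force
    show "cmod (w x) powr - r \<le> (c / 2) powr - r * (case x of (a, b) \<Rightarrow> g a * g b)"
    \<comment> \<open>The origin contributes nothing because \<open>0 powr - r = 0\<close>;
      elsewhere \<open>A + B \<ge> 1\<close> absorbs the 1 in \<open>1 + A + B\<close>.\<close>
    proof (cases "x = (0, 0)")
      case False
      define A B where "A = \<bar>real_of_int a\<bar>" and "B = \<bar>real_of_int b\<bar>"
      have AB: "A \<ge> 0" "B \<ge> 0" "A + B \<ge> 1"
        using False x by (auto simp: A_def B_def)
      have "(1 + A) * (1 + B) \<le> (1 + A + B)\<^sup>2"
        using AB by (simp add: power2_eq_square algebra_simps)
      also have "\<dots> \<le> (2 * (A + B))\<^sup>2"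
        using AB by (intro power_mono) auto
      finally have "sqrt ((1 + A) * (1 + B)) \<le> 2 * (A + B)"
        using AB by (intro real_le_lsqrt) auto
      hence "(c / 2) * sqrt ((1 + A) * (1 + B)) \<le> (c / 2) * (2 * (A + B))"
        using c by (intro mult_left_mono) auto
      also have "\<dots> \<le> cmod (w x)" using c(2)[of a b] by (simp add: w_def x A_def B_def field_simps)
      finally have "cmod (w x) powr - r \<le> ((c / 2) * sqrt ((1 + A) * (1 + B))) powr - r"
        using c AB assms by (intro powr_mono2') auto
      also have "\<dots> = (c / 2) powr - r * (sqrt ((1 + A) * (1 + B)) powr - r)"
        using c AB by (subst powr_mult) auto
      also have "sqrt ((1 + A) * (1 + B)) powr - r = ((1 + A) * (1 + B)) powr - (r / 2)"
        using AB by (simp add: powr_half_sqrt[symmetric] powr_powr)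
      also have "\<dots> = g a * g b"
        using AB by (subst powr_mult) (auto simp: g_def A_def B_def)
      finally show ?thesis by (simp add: x)
    qed (simp add: w_def g_def)
  qed auto
  moreover have "inj w"
  proof (rule injI)
    fix x y assume "w x = w y"
    moreover obtain a b a' b' where xy: "x = (a, b)" "y = (a', b')" by (metis surj_pair)
    ultimately have *: "of_int a + of_int b * \<tau> = of_int a' + of_int b' * \<tau>" by (simp add: w_def)
    from arg_cong[OF this, of Im] assms(1) have "b = b'" by simp
    with * show "x = y" by (simp add: xy)
  qed
  ultimately have "(\<lambda>\<omega>. cmod \<omega> powr - r) summable_on (range w)"
    by (subst summable_on_reindex) (auto simp: o_def)
  also have "range w = period_lattice \<tau>"
    by (auto simp: period_lattice_def w_def image_iff)
  finally show ?thesis .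
qed

section \<open>Locally dominated series of holomorphic functions\<close>

text \<open>A local form of the hypothesis of the Weierstrass M-test. The finite exception set
  \<open>K\<close> is there because the estimates hold only for large indices; it also lets terms
  with a pole in the disc be disregarded.\<close>

definition locally_dominated :: "'a set \<Rightarrow> complex set \<Rightarrow> ('a \<Rightarrow> complex \<Rightarrow> complex) \<Rightarrow> bool" where
  "locally_dominated X A f \<longleftrightarrow> (\<forall>s0\<in>A. \<exists>r>0. \<exists>K g. finite K \<and> g summable_on X \<and>
     (\<forall>w\<in>X - K. \<forall>s\<in>cball s0 r. norm (f w s) \<le> g w))"

lemma locally_dominatedE:
  assumes "locally_dominated X A f" "open A" "s0 \<in> A"
  obtains r K g where "r > 0" "cball s0 r \<subseteq> A" "finite K" "g summable_on X"
    "\<And>w s. w \<in> X - K \<Longrightarrow> s \<in> cball s0 r \<Longrightarrow> norm (f w s) \<le> g w"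
proof -
  obtain r K g where *: "r > 0" "finite K" "g summable_on X"
    "\<forall>w\<in>X - K. \<forall>s\<in>cball s0 r. norm (f w s) \<le> g w"
    using assms(1,3) unfolding locally_dominated_def by blast
  obtain r' where r': "r' > 0" "cball s0 r' \<subseteq> A"
    using assms by (meson open_contains_cball)
  show ?thesis
    by (rule that[of "min r r'" K g]) (use * r' in auto)
qed

lemma locally_dominated_abs_summable:
  assumes "locally_dominated X A f" "s \<in> A"
  shows "(\<lambda>w. norm (f w s)) summable_on X"
proof -
  obtain r K g where *: "r > 0" "finite K" "g summable_on X"
    "\<forall>w\<in>X - K. \<forall>s\<in>cball s r. norm (f w s) \<le> g w"
    using assms unfolding locally_dominated_def by blast
  have "g summable_on X - K" using *(3) summable_on_subset by blast
  hence "(\<lambda>w. norm (f w s)) summable_on X - K"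
    by (rule summable_on_comparison_test) (use * in auto)
  hence "(\<lambda>w. norm (f w s)) summable_on (X - K) \<union> (X \<inter> K)"
    by (rule summable_on_union) (use * in \<open>auto intro!: summable_on_finite\<close>)
  also have "(X - K) \<union> (X \<inter> K) = X" by blast
  finally show ?thesis .
qed

lemma locally_dominated_summable:
  assumes "locally_dominated X A f" "s \<in> A"
  shows "(\<lambda>w. f w s) summable_on X"
  using locally_dominated_abs_summable[OF assms] by (rule abs_summable_summable)

lemma locally_dominated_uniform_limit:
  assumes "locally_dominated X A f" "open A" "\<And>w. w \<in> X \<Longrightarrow> f w holomorphic_on A" "s0 \<in> A"
  obtains r where "r > 0" "cball s0 r \<subseteq> A"
    "uniform_limit (cball s0 r) (\<lambda>Y s. \<Sum>w\<in>Y. f w s) (\<lambda>s. \<Sum>\<^sub>\<infinity>w\<in>X. f w s) (finite_subsets_at_top X)"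
proof -
  obtain r K g where *: "r > 0" "cball s0 r \<subseteq> A" "finite K" "g summable_on X"
    "\<And>w s. w \<in> X - K \<Longrightarrow> s \<in> cball s0 r \<Longrightarrow> norm (f w s) \<le> g w"
    using locally_dominatedE[OF assms(1,2,4)] by metis
  have "\<exists>B. \<forall>s\<in>cball s0 r. norm (f w s) \<le> B" if "w \<in> X" for w
  proof -
    have "continuous_on (cball s0 r) (f w)"
      using assms(3)[OF that] *(2) holomorphic_on_imp_continuous_on continuous_on_subset by blast
    hence "bounded (f w ` cball s0 r)" by (intro compact_imp_bounded compact_continuous_image) auto
    thus ?thesis unfolding bounded_iff by auto
  qed
  then obtain B where B: "\<And>w s. w \<in> X \<Longrightarrow> s \<in> cball s0 r \<Longrightarrow> norm (f w s) \<le> B w" by metis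
  \<comment> \<open>On \<open>K\<close> the majorant is patched by a bound from compactness of the
    disc, where each term is continuous.\<close>
  define M where "M = (\<lambda>w. if w \<in> K then B w else g w)"
  have "M summable_on X - K \<longleftrightarrow> g summable_on X - K"
    by (intro summable_on_cong) (auto simp: M_def)
  hence "M summable_on (X - K)" using *(4) summable_on_subset by blast
  hence "M summable_on (X - K) \<union> (X \<inter> K)"
    by (rule summable_on_union) (use * in \<open>auto intro!: summable_on_finite\<close>)
  also have "(X - K) \<union> (X \<inter> K) = X" by blast
  finally have "uniform_limit (cball s0 r) (\<lambda>Y s. \<Sum>w\<in>Y. f w s) (\<lambda>s. \<Sum>\<^sub>\<infinity>w\<in>X. f w s) (finite_subsets_at_top X)"
    by (intro Weierstrass_m_test_general[of _ _ _ M]) (use * B in \<open>auto simp: M_def\<close>)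
  thus ?thesis using that * by blast
qed

lemma locally_dominated_holomorphic:
  assumes "locally_dominated X A f" "open A" "\<And>w. w \<in> X \<Longrightarrow> f w holomorphic_on A"
  shows "(\<lambda>s. \<Sum>\<^sub>\<infinity>w\<in>X. f w s) holomorphic_on A"
proof -
  have "(\<lambda>s. \<Sum>\<^sub>\<infinity>w\<in>X. f w s) analytic_on {s0}" if s0: "s0 \<in> A" for s0
  proof -
    obtain r where r: "r > 0" "cball s0 r \<subseteq> A"
      "uniform_limit (cball s0 r) (\<lambda>Y s. \<Sum>w\<in>Y. f w s) (\<lambda>s. \<Sum>\<^sub>\<infinity>w\<in>X. f w s) (finite_subsets_at_top X)"
      using locally_dominated_uniform_limit[OF assms s0] by metis
    have "continuous_on (cball s0 r) (\<lambda>s. \<Sum>w\<in>Y. f w s) \<and>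
            (\<lambda>s. \<Sum>w\<in>Y. f w s) holomorphic_on ball s0 r" if "finite Y" "Y \<subseteq> X" for Y
    proof -
      have holo: "(\<lambda>s. \<Sum>w\<in>Y. f w s) holomorphic_on cball s0 r"
        using that assms(3) by (intro holomorphic_intros) (blast intro: holomorphic_on_subset[OF _ r(2)])
      thus ?thesis
        using holomorphic_on_imp_continuous_on[OF holo] holomorphic_on_subset[OF holo ball_subset_cball]
        by simp
    qed
    hence "\<forall>\<^sub>F Y in finite_subsets_at_top X. continuous_on (cball s0 r) (\<lambda>s. \<Sum>w\<in>Y. f w s) \<and>
             (\<lambda>s. \<Sum>w\<in>Y. f w s) holomorphic_on ball s0 r"
      by (rule eventually_finite_subsets_at_top_weakI)
    hence "(\<lambda>s. \<Sum>\<^sub>\<infinity>w\<in>X. f w s) holomorphic_on ball s0 r"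
      using r(3) by (rule holomorphic_uniform_limit) auto
    thus ?thesis using r(1) by (auto simp: analytic_at_ball)
  qed
  thus ?thesis using analytic_imp_holomorphic analytic_on_analytic_at by blast
qed

text \<open>Locally uniform convergence passes to derivatives, so a Taylor coefficient of a lattice
  sum is the sum of the Taylor coefficients of its terms. The Laurent coefficients at the end come
  from here.\<close>

lemma locally_dominated_higher_deriv:
  assumes "locally_dominated X A f" "open A" "\<And>w. w \<in> X \<Longrightarrow> f w holomorphic_on A" "s \<in> A"
  shows "((\<lambda>w. (deriv ^^ n) (f w) s) has_sum (deriv ^^ n) (\<lambda>s. \<Sum>\<^sub>\<infinity>w\<in>X. f w s) s) X"
proof -
  obtain r where r: "r > 0" "cball s r \<subseteq> A"
    "uniform_limit (cball s r) (\<lambda>Y s. \<Sum>w\<in>Y. f w s) (\<lambda>s. \<Sum>\<^sub>\<infinity>w\<in>X. f w s) (finite_subsets_at_top X)"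
    using locally_dominated_uniform_limit[OF assms] by metis
  have holo: "f w holomorphic_on ball s r" if "w \<in> X" for w
    using assms(3)[OF that] r(2) ball_subset_cball holomorphic_on_subset order_trans by metis
  have "((\<lambda>Y. (deriv ^^ n) (\<lambda>s. \<Sum>w\<in>Y. f w s) s) \<longlongrightarrow> (deriv ^^ n) (\<lambda>s. \<Sum>\<^sub>\<infinity>w\<in>X. f w s) s)
          (finite_subsets_at_top X)"
  proof (rule higher_deriv_complex_uniform_limit)
    show "uniform_limit (ball s r) (\<lambda>Y s. \<Sum>w\<in>Y. f w s) (\<lambda>s. \<Sum>\<^sub>\<infinity>w\<in>X. f w s) (finite_subsets_at_top X)"
      using r(3) by (rule uniform_limit_on_subset) auto
    show "\<forall>\<^sub>F Y in finite_subsets_at_top X. (\<lambda>s. \<Sum>w\<in>Y. f w s) holomorphic_on ball s r"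
      by (intro eventually_finite_subsets_at_top_weakI holomorphic_intros) (use holo in auto)
  qed (use r in auto)
  moreover have "(deriv ^^ n) (\<lambda>s. \<Sum>w\<in>Y. f w s) s = (\<Sum>w\<in>Y. (deriv ^^ n) (f w) s)"
    if "finite Y" "Y \<subseteq> X" for Y
    using that
  proof (induction Y rule: finite_induct)
    case empty
    then show ?case by (simp add: higher_deriv_const)
  next
    case (insert w Y)
    have "(deriv ^^ n) (\<lambda>s. f w s + (\<Sum>w\<in>Y. f w s)) s =
            (deriv ^^ n) (f w) s + (deriv ^^ n) (\<lambda>s. \<Sum>w\<in>Y. f w s) s"
      by (rule higher_deriv_add[where S = "ball s r"])
        (use insert holo r in \<open>auto intro!: holomorphic_intros\<close>)
    with insert show ?case by simp
  qed
  ultimately show ?thesis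
    unfolding has_sum_def
    by (elim Lim_transform_eventually) (auto intro!: eventually_finite_subsets_at_top_weakI)
qed

section \<open>Second and third order differences of Eisenstein terms\<close>

text \<open>Cauchy's estimate on discs of radius \<open>R / 4\<close> about points of the unit disc,
  which stay inside \<open>ball 0 R\<close> because \<open>R \<ge> 2\<close>. With \<open>R\<close>
  proportional to \<open>|z|\<close>, each further Taylor term gains one power of
  \<open>|z|\<close>. The factor \<open>Suc n\<close> is
  \<open>fact (Suc n) / fact n\<close>.\<close>

lemma holomorphic_taylor_bound:
  assumes holo: "h holomorphic_on ball 0 R" and bound: "\<And>t. t \<in> ball 0 R \<Longrightarrow> cmod (h t) < M"
    and R: "R \<ge> 2" and t: "cmod t \<le> 1"
  shows "cmod (h t - (\<Sum>i\<le>n. (deriv ^^ i) h 0 * t ^ i / fact i)) \<le> (of_nat (Suc n) * M * 4 ^ Suc n) / R ^ Suc n"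
proof -
  define B where "B = fact (Suc n) * M / (R / 4) ^ Suc n"
  have B: "cmod ((deriv ^^ Suc n) h u) \<le> B" if "cmod u \<le> 1" for u
  proof -
    have sub: "cball u (R / 4) \<subseteq> ball 0 R"
      using that R by (auto simp: subset_iff dist_norm) (smt (verit) norm_triangle_sub norm_minus_commute)
    show ?thesis
      unfolding B_def
    proof (rule Cauchy_higher_deriv_bound[where y = 0])
      show "h holomorphic_on ball u (R / 4)"
        using holo sub ball_subset_cball holomorphic_on_subset by (metis order_trans)
      show "continuous_on (cball u (R / 4)) h"
        using holo sub holomorphic_on_imp_continuous_on holomorphic_on_subset by blast
      show "h w \<in> ball 0 M" if "w \<in> ball u (R / 4)" for w
        using that sub bound[of w] by (auto simp: subset_iff)
    qed (use R in auto)
  qed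
  have "cmod ((deriv ^^ 0) h t - (\<Sum>i\<le>n. (deriv ^^ i) h 0 * (t - 0) ^ i / fact i))
          \<le> B * cmod (t - 0) ^ Suc n / fact n"
  proof (rule complex_Taylor[where S = "cball 0 1" and f = "\<lambda>i. (deriv ^^ i) h"])
    fix i x assume x: "x \<in> cball (0::complex) 1"
    have "(deriv ^^ i) h holomorphic_on ball 0 R"
      by (intro holomorphic_higher_deriv holo) auto
    hence "((deriv ^^ i) h has_field_derivative deriv ((deriv ^^ i) h) x) (at x within cball 0 1)"
      by (rule holomorphic_derivI) (use x R in auto)
    thus "((deriv ^^ i) h has_field_derivative (deriv ^^ Suc i) h x) (at x within cball 0 1)"
      by simp
  qed (use B t in auto)
  also have "\<dots> \<le> B * 1 / fact n"
  proof -
    have "B \<ge> 0" using B[of 0] norm_ge_zero order_trans by (metis norm_zero zero_le_one)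
    thus ?thesis using t
      by (intro divide_right_mono mult_left_mono power_le_one) auto
  qed
  also have "\<dots> = (of_nat (Suc n) * M * 4 ^ Suc n) / R ^ Suc n"
    by (simp add: B_def power_divide)
  finally show ?thesis by simp
qed

text \<open>At \<open>z = 0\<close> the conventions for \<open>powr\<close> and division give the
  value 0. This realizes the omission of \<open>\<omega> = -\<alpha>\<close>, so all later sums run
  over the full lattice and can be translated.\<close>

definition eis_term :: "nat \<Rightarrow> complex \<Rightarrow> complex \<Rightarrow> complex" where
  "eis_term j s z = 1 / z ^ j * of_real (cmod z) powr (- 2 * s)"

lemma norm_eis_term:
  assumes "z \<noteq> 0"
  shows "cmod (eis_term j s z) = cmod z powr - (real j + 2 * Re s)"
proof -
  have "cmod z powr - (real j + 2 * Re s) = cmod z powr - real j * cmod z powr - (2 * Re s)"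
    by (simp add: powr_add[symmetric])
  also have "cmod z powr - real j = 1 / cmod z ^ j"
    using assms by (simp add: powr_minus powr_realpow divide_inverse)
  finally show ?thesis
    by (simp add: eis_term_def norm_mult norm_divide norm_power norm_powr_real_powr)
qed

lemma eis_term_at_0: "j \<ge> 1 \<Longrightarrow> eis_term j 0 z = 1 / z ^ j"
  by (cases "z = 0") (auto simp: eis_term_def)

lemma eis_term_holomorphic [holomorphic_intros]: "(\<lambda>s. eis_term j s z) holomorphic_on A"
  by (cases "z = 0") (auto simp: eis_term_def intro!: holomorphic_intros)

text \<open>The function \<open>t \<mapsto> (a + t b) eis_term j s (z + t v)\<close> of the real variable \<open>t\<close>, continued to
  complex \<open>t\<close> by writing \<open>|1 + u|\<^sup>2 = (1 + u) (1 + cnj u)\<close>.\<close>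

definition eis_line :: "complex \<Rightarrow> complex \<Rightarrow> nat \<Rightarrow> complex \<Rightarrow> complex \<Rightarrow> complex \<Rightarrow> complex \<Rightarrow> complex" where
  "eis_line a b j s z v t = (a + t * b) * eis_term j s z / (1 + t * (v / z)) ^ j *
     exp (- s * (Ln (1 + t * (v / z)) + Ln (1 + t * cnj (v / z))))"

lemma one_plus_notin_nonpos_Reals:
  assumes "cmod x < 1"
  shows "1 + x \<notin> \<real>\<^sub>\<le>\<^sub>0"
proof
  assume "1 + x \<in> \<real>\<^sub>\<le>\<^sub>0"
  hence "Re (1 + x) \<le> 0" by (simp add: complex_nonpos_Reals_iff)
  with abs_Re_le_cmod[of x] assms show False by simp
qed

lemma norm_Ln_one_plus_le:
  assumes "cmod x \<le> 1 / 2"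
  shows "cmod (Ln (1 + x)) \<le> 1"
proof -
  have "cmod (Ln (1 + x) - x) \<le> cmod x ^ 2 / (1 - cmod x)"
    by (rule Ln_approx_linear) (use assms in auto)
  also have "\<dots> \<le> (1/2) ^ 2 / (1 / 2)"
    using assms by (intro frac_le power_mono) auto
  finally have "cmod (Ln (1 + x) - x) \<le> 1 / 2" by (simp add: power2_eq_square)
  thus ?thesis using assms norm_triangle_sub[of "Ln (1 + x)" x] by linarith
qed

text \<open>For real \<open>t\<close> the two logarithms are conjugate, since \<open>1 + x\<close>
  lies in the right half-plane; their sum is \<open>2 ln |1 + x|\<close>, and the exponential
  becomes \<open>|1 + x|\<close> to the power \<open>-2 s\<close>.\<close>

lemma eis_line_of_real:
  assumes z: "z \<noteq> 0" and t: "cmod (of_real t * (v / z)) < 1"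
  shows "eis_line a b j s z v (of_real t) = (a + of_real t * b) * eis_term j s (z + of_real t * v)"
proof -
  define x where "x = of_real t * (v / z)"
  have x: "cmod x < 1" using t by (simp add: x_def)
  have nz: "1 + x \<noteq> 0" using one_plus_notin_nonpos_Reals[OF x] by auto
  have eq: "z + of_real t * v = z * (1 + x)" using z by (simp add: x_def field_simps)
  have cnj: "of_real t * cnj (v / z) = cnj x" by (simp add: x_def)
  have "Ln (1 + cnj x) = cnj (Ln (1 + x))"
    using cnj_Ln[OF one_plus_notin_nonpos_Reals[OF x]] by simp
  hence "Ln (1 + x) + Ln (1 + cnj x) = of_real (2 * Re (Ln (1 + x)))"
    by (simp add: complex_add_cnj)
  also have "\<dots> = 2 * of_real (ln (cmod (1 + x)))" using nz by (simp add: Re_Ln)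
  finally have "exp (- s * (Ln (1 + x) + Ln (1 + cnj x))) = exp (- 2 * s * of_real (ln (cmod (1 + x))))"
    by (simp add: algebra_simps)
  also have "\<dots> = of_real (cmod (1 + x)) powr (- 2 * s)"
    using nz by (simp add: powr_def Ln_of_real)
  finally have e: "exp (- s * (Ln (1 + x) + Ln (1 + cnj x))) = of_real (cmod (1 + x)) powr (- 2 * s)" .
  have "of_real (cmod (z * (1 + x))) powr (- 2 * s) =
          of_real (cmod z) powr (- 2 * s) * of_real (cmod (1 + x)) powr (- 2 * s)"
  proof -
    have "ln (cmod (z * (1 + x))) = ln (cmod z) + ln (cmod (1 + x))"
      using nz z by (simp add: norm_mult ln_mult)
    moreover have "z * (1 + x) \<noteq> 0" using nz z by simp
    ultimately show ?thesis
      using nz z by (simp add: powr_def Ln_of_real exp_add[symmetric] algebra_simps del: mult_eq_0_iff)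
  qed
  thus ?thesis
    unfolding eis_line_def eis_term_def eq cnj x_def[symmetric] e by (simp add: power_mult_distrib)
qed

text \<open>On \<open>ball 0 R\<close> the quantity \<open>t v / z\<close> has modulus at most 1/2.
  Hence \<open>1 + t v / z\<close> stays away from 0 and from the cut, which gives the factor
  \<open>2 ^ j\<close>, and each logarithm has modulus at most 1, which gives
  \<open>exp (2 |s|)\<close>.\<close>

lemma
  assumes z: "z \<noteq> 0" and R: "R * cmod v \<le> cmod z / 2"
  shows eis_line_holomorphic: "eis_line a b j s z v holomorphic_on ball 0 R"
    and norm_eis_line_less: "A > 0 \<Longrightarrow> cmod a \<le> A \<Longrightarrow> R * cmod b \<le> A \<Longrightarrow> t \<in> ball 0 R \<Longrightarrow>
      cmod (eis_line a b j s z v t) < 4 * A * 2 ^ j * exp (2 * cmod s) * cmod (eis_term j s z)"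
proof -
  have u: "cmod (t * (v / z)) \<le> 1 / 2" "cmod (t * cnj (v / z)) \<le> 1 / 2" if "t \<in> ball 0 R" for t
  proof -
    have "cmod t * cmod v \<le> R * cmod v" using that by (intro mult_right_mono) auto
    with R have "cmod t * cmod v \<le> cmod z / 2" by linarith
    thus "cmod (t * (v / z)) \<le> 1 / 2" "cmod (t * cnj (v / z)) \<le> 1 / 2"
      using z by (simp_all add: norm_mult norm_divide field_simps)
  qed
  have nonpos: "1 + t * (v / z) \<notin> \<real>\<^sub>\<le>\<^sub>0" "1 + t * cnj (v / z) \<notin> \<real>\<^sub>\<le>\<^sub>0" if "t \<in> ball 0 R" for t
    using u[OF that] by (intro one_plus_notin_nonpos_Reals; linarith)+
  have nz: "1 + t * (v / z) \<noteq> 0" if "t \<in> ball 0 R" for t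
    using nonpos(1)[OF that] by (metis nonpos_Reals_zero_I)
  show "eis_line a b j s z v holomorphic_on ball 0 R"
    unfolding eis_line_def
    by (intro holomorphic_intros) (use nonpos nz in auto)
  assume A: "A > 0" "cmod a \<le> A" "R * cmod b \<le> A" and t: "t \<in> ball 0 R"
  have "cmod t * cmod b \<le> R * cmod b" using t by (intro mult_right_mono) auto
  hence 1: "cmod (a + t * b) \<le> 2 * A"
    using A norm_triangle_ineq[of a "t * b"] by (simp add: norm_mult)
  have "1 / 2 \<le> cmod (1 + t * (v / z))"
    using u(1)[OF t] norm_triangle_ineq2[of 1 "- (t * (v / z))"] by simp
  hence "(1 / 2) ^ j \<le> cmod (1 + t * (v / z)) ^ j" by (intro power_mono) auto
  hence 2: "1 / cmod (1 + t * (v / z)) ^ j \<le> 2 ^ j"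
    using nz[OF t] by (simp add: field_simps)
  have "Re (- s * (Ln (1 + t * (v / z)) + Ln (1 + t * cnj (v / z))))
          \<le> cmod (- s * (Ln (1 + t * (v / z)) + Ln (1 + t * cnj (v / z))))"
    by (rule complex_Re_le_cmod)
  also have "\<dots> \<le> cmod s * (1 + 1)"
    unfolding norm_mult norm_minus_cancel
    by (intro mult_left_mono norm_triangle_le add_mono norm_Ln_one_plus_le u t) auto
  finally have 3: "cmod (exp (- s * (Ln (1 + t * (v / z)) + Ln (1 + t * cnj (v / z))))) \<le> exp (2 * cmod s)"
    by (simp add: mult.commute)
  have "cmod (eis_line a b j s z v t) = cmod (a + t * b) * (1 / cmod (1 + t * (v / z)) ^ j) *
          cmod (exp (- s * (Ln (1 + t * (v / z)) + Ln (1 + t * cnj (v / z))))) * cmod (eis_term j s z)"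
    by (simp add: eis_line_def norm_mult norm_divide norm_power)
  also have "\<dots> \<le> 2 * A * 2 ^ j * exp (2 * cmod s) * cmod (eis_term j s z)"
    by (intro mult_mono 1 2 3) (use A in auto)
  \<comment> \<open>The constant is doubled to make the bound strict, since Cauchy's estimate is
    applied with values in an open ball.\<close>
  also have "\<dots> < 4 * A * 2 ^ j * exp (2 * cmod s) * cmod (eis_term j s z)"
    using A z by (intro mult_strict_right_mono) (auto simp: norm_eis_term)
  finally show "cmod (eis_line a b j s z v t) < 4 * A * 2 ^ j * exp (2 * cmod s) * cmod (eis_term j s z)" .
qed

lemma deriv_eis_line:
  assumes "z \<noteq> 0"
  shows "deriv (eis_line a b j s z v) 0 =
     eis_term j s z * (b - a * (of_nat j * (v / z) + s * (v / z + cnj (v / z))))"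
proof -
  have "((\<lambda>t. (a + t * b) * eis_term j s z * (inverse (1 + t * (v / z))) ^ j *
     exp (- s * (Ln (1 + t * (v / z)) + Ln (1 + t * cnj (v / z))))) has_field_derivative
     eis_term j s z * (b - a * (of_nat j * (v / z) + s * (v / z + cnj (v / z))))) (at 0)"
    using assms by (auto intro!: derivative_eq_intros simp: algebra_simps)
  also have "(\<lambda>t. (a + t * b) * eis_term j s z * (inverse (1 + t * (v / z))) ^ j *
     exp (- s * (Ln (1 + t * (v / z)) + Ln (1 + t * cnj (v / z))))) = eis_line a b j s z v"
    by (simp add: eis_line_def fun_eq_iff divide_inverse power_inverse)
  finally show ?thesis by (rule DERIV_imp_deriv)
qed

text \<open>\<open>d\<close> is the derivative at 0 of the continued line through \<open>z\<close>
  in direction \<open>v\<close>, holomorphic on a disc of radius \<open>R = |z| / (2 V)\<close>. The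
  constants are Taylor remainders in terms of \<open>R\<close>:
  \<open>2 * 4 * 4^2 * 2^2 = 512\<close> for one value, and
  \<open>2 * (3 * 4 * 4^3) * 2^3 = 12288\<close> for the symmetric difference.\<close>

lemma
  fixes z v a b s :: complex and j :: nat
  assumes V: "cmod v \<le> V" "V > 0" "4 * V \<le> cmod z" and A: "A > 0" "cmod a \<le> A" "cmod z / (2 * V) * cmod b \<le> A"
  defines "u \<equiv> v / z"
  defines "d \<equiv> eis_term j s z * (b - a * (of_nat j * u + s * (u + cnj u)))"
  defines "M \<equiv> A * 2 ^ j * exp (2 * cmod s) * cmod (eis_term j s z)"
  shows eis_term_diff2: "cmod ((a + b) * eis_term j s (z + v) - a * eis_term j s z - d)
            \<le> 512 * M * V ^ 2 / cmod z ^ 2"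
    and eis_term_diff3: "cmod ((a + b) * eis_term j s (z + v) - (a - b) * eis_term j s (z - v) - 2 * d)
            \<le> 12288 * M * V ^ 3 / cmod z ^ 3"
proof -
  define R where "R = cmod z / (2 * V)"
  define h where "h = eis_line a b j s z v"
  have z: "z \<noteq> 0" using V by auto
  have R: "R \<ge> 2" using V by (simp add: R_def field_simps)
  have Rv: "R * cmod v \<le> cmod z / 2"
    using V mult_left_mono[OF V(1), of "cmod z"] by (simp add: R_def field_simps)
  have holo: "h holomorphic_on ball 0 R" unfolding h_def by (rule eis_line_holomorphic[OF z Rv])
  have less: "cmod (h t) < 4 * M" if "t \<in> ball 0 R" for t
    using norm_eis_line_less[OF z Rv A(1,2) _ that, of b] A(3) by (simp add: h_def M_def R_def mult_ac)
  have "cmod (of_real t * (v / z)) < 1" if "\<bar>t\<bar> \<le> 1" for t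
  proof -
    have "\<bar>t\<bar> * cmod v \<le> 1 * V" using that V by (intro mult_mono) auto
    also have "\<dots> < cmod z" using V by simp
    finally show ?thesis using z by (simp add: norm_mult norm_divide field_simps)
  qed
  note real = eis_line_of_real[OF z this]
  have h1: "h 1 = (a + b) * eis_term j s (z + v)" using real[of 1] by (simp add: h_def)
  have hm1: "h (-1) = (a - b) * eis_term j s (z - v)" using real[of "-1"] by (simp add: h_def)
  have h0: "h 0 = a * eis_term j s z" using real[of 0] by (simp add: h_def)
  have h': "deriv h 0 = d" unfolding h_def d_def u_def by (rule deriv_eis_line[OF z])
  have taylor: "cmod (h t - (\<Sum>i\<le>n. (deriv ^^ i) h 0 * t ^ i / fact i))
      \<le> of_nat (Suc n) * (4 * M) * 4 ^ Suc n / R ^ Suc n" if "cmod t \<le> 1" for t n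
    using holo less R that by (rule holomorphic_taylor_bound)
  have "cmod (h 1 - (\<Sum>i\<le>1. (deriv ^^ i) h 0 * 1 ^ i / fact i)) \<le> of_nat (Suc 1) * (4 * M) * 4 ^ Suc 1 / R ^ Suc 1"
    by (rule taylor) auto
  also have "\<dots> = 128 * M / R ^ 2" by (simp add: power2_eq_square)
  also have "\<dots> = 512 * M * V ^ 2 / cmod z ^ 2"
    by (simp add: R_def power_divide power_mult_distrib)
  finally show "cmod ((a + b) * eis_term j s (z + v) - a * eis_term j s z - d) \<le> 512 * M * V ^ 2 / cmod z ^ 2"
    by (simp add: h1 h0 h' algebra_simps)
  have T: "cmod (h t - (\<Sum>i\<le>2. (deriv ^^ i) h 0 * t ^ i / fact i)) \<le> 768 * M / R ^ 3" if "cmod t \<le> 1" for t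
  proof -
    have "Suc 2 = 3" by simp
    with taylor[OF that, of 2] show ?thesis by (simp only:) simp
  qed
  \<comment> \<open>The terms of degree 0 and 2 are even in \<open>t\<close> and cancel between 1
    and -1, so the symmetric difference is accurate to third order.\<close>
  have "(h 1 - (\<Sum>i\<le>2. (deriv ^^ i) h 0 * 1 ^ i / fact i)) - (h (-1) - (\<Sum>i\<le>2. (deriv ^^ i) h 0 * (-1) ^ i / fact i))
          = h 1 - h (-1) - 2 * deriv h 0"
    by (simp add: numeral_2_eq_2)
  moreover have "cmod ((h 1 - (\<Sum>i\<le>2. (deriv ^^ i) h 0 * 1 ^ i / fact i))
      - (h (-1) - (\<Sum>i\<le>2. (deriv ^^ i) h 0 * (-1) ^ i / fact i))) \<le> 768 * M / R ^ 3 + 768 * M / R ^ 3"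
    by (rule order.trans[OF norm_triangle_ineq4 add_mono[OF T T]]) auto
  ultimately have "cmod (h 1 - h (-1) - 2 * deriv h 0) \<le> 768 * M / R ^ 3 + 768 * M / R ^ 3"
    by (simp only:)
  also have "\<dots> = 12288 * M * V ^ 3 / cmod z ^ 3"
    by (simp add: R_def power_divide power_mult_distrib)
  finally show "cmod ((a + b) * eis_term j s (z + v) - (a - b) * eis_term j s (z - v) - 2 * d)
            \<le> 12288 * M * V ^ 3 / cmod z ^ 3"
    by (simp add: h1 hm1 h')
qed

section \<open>Analytic continuation of the Eisenstein series\<close>

lemma has_sum_diff:
  fixes f g :: "'a \<Rightarrow> 'b :: real_normed_vector"
  assumes "(f has_sum a) A" "(g has_sum b) A"
  shows "((\<lambda>x. f x - g x) has_sum a - b) A"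
  using has_sum_add[OF assms(1), of "\<lambda>x. - g x" "- b"] assms(2) by (simp add: has_sum_uminus)

lemma has_sum_sum:
  fixes f :: "'i \<Rightarrow> 'a \<Rightarrow> 'b :: real_normed_vector"
  assumes "finite I" "\<And>i. i \<in> I \<Longrightarrow> (f i has_sum a i) A"
  shows "((\<lambda>x. \<Sum>i\<in>I. f i x) has_sum (\<Sum>i\<in>I. a i)) A"
  using assms by (induction I rule: finite_induct) (auto intro!: has_sum_add)

lemma finite_period_lattice_ball_shifted:
  assumes "Im \<tau> > 0"
  shows "finite {\<omega> \<in> period_lattice \<tau>. cmod (\<alpha> + \<omega>) \<le> R}"
proof (rule finite_subset[OF _ finite_period_lattice_ball[OF assms, of "R + cmod \<alpha>"]])
  show "{\<omega> \<in> period_lattice \<tau>. cmod (\<alpha> + \<omega>) \<le> R} \<subseteq> {\<omega> \<in> period_lattice \<tau>. cmod \<omega> \<le> R + cmod \<alpha>}"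
    using norm_triangle_ineq4[of "\<alpha> + \<omega>" \<alpha> for \<omega>] by (force intro: order.trans)
qed

lemma summable_on_period_lattice_shifted_powr:
  assumes "Im \<tau> > 0" "r > 2"
  shows "(\<lambda>\<omega>. cmod (\<alpha> + \<omega>) powr - r) summable_on period_lattice \<tau>"
proof -
  define K where "K = {\<omega> \<in> period_lattice \<tau>. cmod \<omega> \<le> 2 * cmod \<alpha>}"
  have K: "finite K" unfolding K_def by (rule finite_period_lattice_ball[OF assms(1)])
  have "(\<lambda>\<omega>. 2 powr r * cmod \<omega> powr - r) summable_on period_lattice \<tau> - K"
    using summable_on_period_lattice_powr[OF assms]
    by (intro summable_on_cmult_right) (rule summable_on_subset, auto)
  hence "(\<lambda>\<omega>. cmod (\<alpha> + \<omega>) powr - r) summable_on period_lattice \<tau> - K"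
  proof (rule summable_on_comparison_test)
    fix \<omega> assume "\<omega> \<in> period_lattice \<tau> - K"
    hence w: "2 * cmod \<alpha> < cmod \<omega>" by (auto simp: K_def)
    have "cmod \<omega> / 2 \<le> cmod (\<alpha> + \<omega>)" using w norm_diff_ineq[of \<omega> \<alpha>] by (simp add: add.commute)
    hence "cmod (\<alpha> + \<omega>) powr - r \<le> (cmod \<omega> / 2) powr - r"
      using w assms by (intro powr_mono2') auto
    also have "\<dots> = 2 powr r * cmod \<omega> powr - r"
      using w by (simp add: powr_divide powr_minus field_simps)
    finally show "cmod (\<alpha> + \<omega>) powr - r \<le> 2 powr r * cmod \<omega> powr - r" .
  qed auto
  hence "(\<lambda>\<omega>. cmod (\<alpha> + \<omega>) powr - r) summable_on (period_lattice \<tau> - K) \<union> K"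
    by (rule summable_on_union) (use K in \<open>auto intro!: summable_on_finite\<close>)
  also have "(period_lattice \<tau> - K) \<union> K = period_lattice \<tau>" by (auto simp: K_def)
  finally show ?thesis .
qed

text \<open>The exponent \<open>k\<close> is the gain in decay over \<open>eis_term\<close>, and the
  half-plane expresses that the total exponent \<open>j + 2 Re s + k\<close> exceeds 2. It is used
  with \<open>k = 0\<close> for plain terms, \<open>k = -1\<close> for terms with a linear weight,
  and \<open>k = 2\<close> for regularized and balanced ones. \<open>C\<close> may depend on the
  bound for \<open>|s|\<close> because of the factor \<open>exp (2 |s|)\<close>.\<close>

lemma period_lattice_locally_dominated:
  assumes \<tau>: "Im \<tau> > 0"
    and bound: "\<And>S. \<exists>C R. \<forall>s w. cmod s \<le> S \<longrightarrow> w \<in> period_lattice \<tau> \<longrightarrow> cmod (\<alpha> + w) \<ge> R \<longrightarrow>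
      cmod (f w s) \<le> C * cmod (eis_term j s (\<alpha> + w)) * cmod (\<alpha> + w) powr - k"
  shows "locally_dominated (period_lattice \<tau>) {s. 1 - (real j + k) / 2 < Re s} f"
  unfolding locally_dominated_def
proof
  fix s0 assume "s0 \<in> {s. 1 - (real j + k) / 2 < Re s}"
  hence s0: "1 - (real j + k) / 2 < Re s0" by simp
  \<comment> \<open>Half of the distance to the boundary line, so that \<sigma>, the least real part
    on the disc, still gives a summable exponent.\<close>
  define r where "r = (Re s0 - (1 - (real j + k) / 2)) / 2"
  define \<sigma> where "\<sigma> = Re s0 - r"
  have r: "r > 0" using s0 by (simp add: r_def)
  have \<sigma>: "real j + 2 * \<sigma> + k > 2" using s0 by (simp add: \<sigma>_def r_def field_simps)
  obtain C R where CR: "\<And>s w. cmod s \<le> cmod s0 + r \<Longrightarrow> w \<in> period_lattice \<tau> \<Longrightarrow> cmod (\<alpha> + w) \<ge> R \<Longrightarrow>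
      cmod (f w s) \<le> C * cmod (eis_term j s (\<alpha> + w)) * cmod (\<alpha> + w) powr - k"
    using bound[of "cmod s0 + r"] by blast
  define K where "K = {w \<in> period_lattice \<tau>. cmod (\<alpha> + w) \<le> max R 1}"
  define g where "g = (\<lambda>w. \<bar>C\<bar> * cmod (\<alpha> + w) powr - (real j + 2 * \<sigma> + k))"
  have "cmod (f w s) \<le> g w" if w: "w \<in> period_lattice \<tau> - K" and s: "s \<in> cball s0 r" for w s
  proof -
    have z: "cmod (\<alpha> + w) \<ge> R" "cmod (\<alpha> + w) > 1" using w by (auto simp: K_def)
    have nz: "\<alpha> + w \<noteq> 0" using z(2) by auto
    have "cmod (s - s0) \<le> r" using s by (simp add: dist_norm norm_minus_commute)
    hence s': "cmod s \<le> cmod s0 + r" "\<sigma> \<le> Re s"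
      using norm_triangle_sub[of s s0] abs_Re_le_cmod[of "s - s0"] by (auto simp: \<sigma>_def)
    have "cmod (f w s) \<le> C * cmod (eis_term j s (\<alpha> + w)) * cmod (\<alpha> + w) powr - k"
      using CR s' w z by blast
    also have "\<dots> \<le> \<bar>C\<bar> * cmod (\<alpha> + w) powr - (real j + 2 * \<sigma>) * cmod (\<alpha> + w) powr - k"
      using z s' by (intro mult_right_mono mult_mono) (auto simp: norm_eis_term[OF nz] intro!: powr_mono)
    also have "\<dots> = g w" by (simp add: g_def powr_add[symmetric] mult.assoc)
    finally show ?thesis .
  qed
  moreover have "g summable_on period_lattice \<tau>"
    unfolding g_def by (intro summable_on_cmult_right summable_on_period_lattice_shifted_powr \<tau> \<sigma>)
  moreover have "finite K" unfolding K_def by (rule finite_period_lattice_ball_shifted[OF \<tau>])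
  ultimately show "\<exists>r>0. \<exists>K g. finite K \<and> g summable_on period_lattice \<tau> \<and>
      (\<forall>w\<in>period_lattice \<tau> - K. \<forall>s\<in>cball s0 r. cmod (f w s) \<le> g w)"
    using r by blast
qed

section \<open>The rotation field and the continuation of a single Eisenstein series\<close>

text \<open>With \<open>rot_snd\<close>, the coordinates of \<open>\<i> z\<close> in the real basis
  \<open>1, \<tau>\<close>. This basis consists of periods, so that derivatives along it can be
  replaced by differences of lattice translates.\<close>

definition rot_fst :: "complex \<Rightarrow> complex \<Rightarrow> real" where
  "rot_fst \<tau> z = - Im z - Re z * (Re \<tau> / Im \<tau>)"

definition rot_snd :: "complex \<Rightarrow> complex \<Rightarrow> real" where
  "rot_snd \<tau> z = Re z / Im \<tau>"

lemma rot_decomp: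
  assumes "Im \<tau> > 0"
  shows "of_real (rot_fst \<tau> z) + of_real (rot_snd \<tau> z) * \<tau> = \<i> * z"
  using assms by (auto simp: complex_eq_iff rot_fst_def rot_snd_def)

lemma rot_add:
  "rot_fst \<tau> (z + w) = rot_fst \<tau> z + rot_fst \<tau> w" "rot_fst \<tau> (z - w) = rot_fst \<tau> z - rot_fst \<tau> w"
  "rot_snd \<tau> (z + w) = rot_snd \<tau> z + rot_snd \<tau> w" "rot_snd \<tau> (z - w) = rot_snd \<tau> z - rot_snd \<tau> w"
  by (simp_all add: rot_fst_def rot_snd_def ring_distribs add_divide_distrib diff_divide_distrib)

lemma rot_bound:
  assumes "Im \<tau> > 0"
  obtains K where "K > 0" "\<And>z. \<bar>rot_fst \<tau> z\<bar> \<le> K * cmod z" "\<And>z. \<bar>rot_snd \<tau> z\<bar> \<le> K * cmod z"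
proof (rule that)
  show "1 + \<bar>Re \<tau> / Im \<tau>\<bar> + 1 / Im \<tau> > 0" using assms by (intro add_pos_nonneg) auto
  fix z
  have "\<bar>rot_fst \<tau> z\<bar> \<le> \<bar>Im z\<bar> + \<bar>Re z\<bar> * \<bar>Re \<tau> / Im \<tau>\<bar>"
    unfolding rot_fst_def abs_mult[symmetric] by linarith
  also have "\<dots> \<le> cmod z + cmod z * \<bar>Re \<tau> / Im \<tau>\<bar>"
    by (intro add_mono mult_right_mono abs_Im_le_cmod abs_Re_le_cmod) auto
  also have "\<dots> \<le> (1 + \<bar>Re \<tau> / Im \<tau>\<bar> + 1 / Im \<tau>) * cmod z"
    using assms by (simp add: algebra_simps)
  finally show "\<bar>rot_fst \<tau> z\<bar> \<le> (1 + \<bar>Re \<tau> / Im \<tau>\<bar> + 1 / Im \<tau>) * cmod z" .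
  have "\<bar>rot_snd \<tau> z\<bar> \<le> 1 / Im \<tau> * cmod z"
    using assms abs_Re_le_cmod[of z] by (simp add: rot_snd_def field_simps)
  also have "\<dots> \<le> (1 + \<bar>Re \<tau> / Im \<tau>\<bar> + 1 / Im \<tau>) * cmod z"
    by (intro mult_right_mono) auto
  finally show "\<bar>rot_snd \<tau> z\<bar> \<le> (1 + \<bar>Re \<tau> / Im \<tau>\<bar> + 1 / Im \<tau>) * cmod z" .
qed

text \<open>Differentiating \<open>\<phi> = eis_term j s\<close> along the divergence-free rotation field \<open>\<i>z = p + q\<tau>\<close>,
  with \<open>p = rot_fst \<tau> z\<close> and \<open>q = rot_snd \<tau> z\<close>, gives \<open>-\<i>j\<phi> = \<partial>\<^sub>1(p\<phi>) + \<partial>\<^sub>\<tau>(q\<phi>)\<close>. Replacing the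
  derivatives by symmetric lattice differences, which sum to zero over the lattice, leaves a term
  that decays faster than \<open>\<phi>\<close> by two powers of \<open>|z|\<close>.\<close>

definition eis_reg :: "complex \<Rightarrow> nat \<Rightarrow> complex \<Rightarrow> complex \<Rightarrow> complex" where
  "eis_reg \<tau> j s z = eis_term j s z + 1 / (2 * \<i> * of_nat j) *
     ((of_real (rot_fst \<tau> (z + 1)) * eis_term j s (z + 1) - of_real (rot_fst \<tau> (z - 1)) * eis_term j s (z - 1)) +
      (of_real (rot_snd \<tau> (z + \<tau>)) * eis_term j s (z + \<tau>) - of_real (rot_snd \<tau> (z - \<tau>)) * eis_term j s (z - \<tau>)))"

lemma eis_reg_holomorphic [holomorphic_intros]: "(\<lambda>s. eis_reg \<tau> j s z) holomorphic_on A"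
  unfolding eis_reg_def by (intro holomorphic_intros)

text \<open>The linear parts of the two symmetric differences add up to
  \<open>-2 \<i> j \<phi>\<close>, which the prefactor \<open>1 / (2 \<i> j)\<close> turns into
  \<open>-\<phi>\<close>, so the main term cancels. The weights have size \<open>|z|\<close>, hence
  a gain of two powers requires remainders of third order; this is why the differences are
  symmetric.\<close>

lemma eis_reg_bound:
  assumes \<tau>: "Im \<tau> > 0" and j: "j \<ge> 1"
  obtains C R where "C \<ge> 0" "\<And>s z. cmod z \<ge> R \<Longrightarrow>
    cmod (eis_reg \<tau> j s z) \<le> C * exp (2 * cmod s) * cmod (eis_term j s z) / cmod z ^ 2"
proof -
  obtain K where K: "K > 0" "\<And>z. \<bar>rot_fst \<tau> z\<bar> \<le> K * cmod z" "\<And>z. \<bar>rot_snd \<tau> z\<bar> \<le> K * cmod z"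
    using rot_bound[OF \<tau>] by metis
  define V where "V = 1 + cmod \<tau>"
  have V: "V > 0" "1 \<le> V" "cmod \<tau> \<le> V" by (auto simp: V_def add_pos_nonneg)
  define C where "C = 12288 * K * 2 ^ j * V ^ 3"
  have C: "C \<ge> 0" using K V by (simp add: C_def)
  have "cmod (eis_reg \<tau> j s z) \<le> C * exp (2 * cmod s) * cmod (eis_term j s z) / cmod z ^ 2"
    if z: "cmod z \<ge> 4 * V" for s z
  proof -
    define \<phi> where "\<phi> = eis_term j s z"
    define p q p1 q1 where "p = complex_of_real (rot_fst \<tau> z)" and "q = complex_of_real (rot_snd \<tau> z)"
      and "p1 = complex_of_real (rot_fst \<tau> 1)" and "q1 = complex_of_real (rot_snd \<tau> \<tau>)"
    define d1 where "d1 = \<phi> * (p1 - p * (of_nat j * (1 / z) + s * (1 / z + cnj (1 / z))))"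
    define d2 where "d2 = \<phi> * (q1 - q * (of_nat j * (\<tau> / z) + s * (\<tau> / z + cnj (\<tau> / z))))"
    define M where "M = (K * cmod z) * 2 ^ j * exp (2 * cmod s) * cmod \<phi>"
    define D1 where "D1 = (p + p1) * eis_term j s (z + 1) - (p - p1) * eis_term j s (z - 1) - 2 * d1"
    define D2 where "D2 = (q + q1) * eis_term j s (z + \<tau>) - (q - q1) * eis_term j s (z - \<tau>) - 2 * d2"
    have z0: "cmod z > 0" using z V by linarith
    have znz: "z \<noteq> 0" using z0 by auto
    have b: "cmod z / (2 * V) * (K * v) \<le> K * cmod z" if "v \<le> V" for v
    proof -
      have "cmod z * K * v \<le> cmod z * K * (2 * V)" using that V K by (intro mult_left_mono) auto
      thus ?thesis using V by (simp add: field_simps)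
    qed
    have D1: "cmod D1 \<le> 12288 * M * V ^ 3 / cmod z ^ 3"
      unfolding D1_def d1_def M_def \<phi>_def
    proof (rule eis_term_diff3)
      show "cmod z / (2 * V) * cmod p1 \<le> K * cmod z"
        using b[of "cmod 1"] K(2)[of 1] V z0 unfolding p1_def norm_of_real
        by (smt (verit) divide_nonneg_pos mult_left_mono norm_one)
    qed (use V z K z0 in \<open>auto simp: p_def\<close>)
    have D2: "cmod D2 \<le> 12288 * M * V ^ 3 / cmod z ^ 3"
      unfolding D2_def d2_def M_def \<phi>_def
    proof (rule eis_term_diff3)
      show "cmod z / (2 * V) * cmod q1 \<le> K * cmod z"
        using b[of "cmod \<tau>"] K(3)[of \<tau>] V z0 unfolding q1_def norm_of_real
        by (smt (verit) divide_nonneg_pos mult_left_mono)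
    qed (use V z K z0 in \<open>auto simp: q_def\<close>)
    \<comment> \<open>The divergence of the rotation field: \<open>p\<close> changes by
      \<open>p1\<close> along 1, and \<open>q\<close> by \<open>q1\<close> along \<tau>.\<close>
    have E0: "p1 + q1 = 0" using \<tau> by (simp add: p1_def q1_def rot_fst_def rot_snd_def flip: of_real_add)
    have E1: "p * (1 / z) + q * (\<tau> / z) = \<i>"
    proof -
      have "p * (1 / z) + q * (\<tau> / z) = (p + q * \<tau>) / z" by (simp add: add_divide_distrib)
      thus ?thesis using znz by (simp add: p_def q_def rot_decomp[OF \<tau>])
    qed
    \<comment> \<open>\<open>p\<close> and \<open>q\<close> are real, so this is the conjugate of
      \<open>E1\<close>. The two cancel in the coefficient of \<open>s\<close>, because
      \<open>|z|\<close> is constant along rotations.\<close>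
    have E2: "p * cnj (1 / z) + q * cnj (\<tau> / z) = - \<i>"
      using arg_cong[OF E1, of cnj] by (simp add: p_def q_def)
    have "d1 + d2 = \<phi> * ((p1 + q1) - of_nat j * (p * (1 / z) + q * (\<tau> / z))
        - s * ((p * (1 / z) + q * (\<tau> / z)) + (p * cnj (1 / z) + q * cnj (\<tau> / z))))"
      unfolding d1_def d2_def by (simp only: ring_distribs mult_ac add_ac diff_diff_eq diff_add_eq add_diff_eq)
    also have "\<dots> = - (\<i> * of_nat j) * \<phi>" unfolding E0 E1 E2 by simp
    finally have d: "d1 + d2 = - (\<i> * of_nat j) * \<phi>" .
    have "eis_reg \<tau> j s z = \<phi> + 1 / (2 * \<i> * of_nat j) * ((D1 + D2) + 2 * (d1 + d2))"
      unfolding eis_reg_def D1_def D2_def \<phi>_def p_def q_def p1_def q1_def rot_add by (simp add: algebra_simps)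
    also have "\<dots> = 1 / (2 * \<i> * of_nat j) * (D1 + D2)"
      unfolding d using j by (simp add: field_simps)
    finally have "cmod (eis_reg \<tau> j s z) = 1 / (2 * real j) * cmod (D1 + D2)"
      by (simp add: norm_mult norm_divide)
    also have "\<dots> \<le> 1 / 2 * cmod (D1 + D2)"
      using j by (intro mult_right_mono) (auto simp: field_simps)
    also have "\<dots> \<le> 1 / 2 * (12288 * M * V ^ 3 / cmod z ^ 3 + 12288 * M * V ^ 3 / cmod z ^ 3)"
      by (intro mult_left_mono norm_triangle_le add_mono D1 D2) auto
    also have "\<dots> = 12288 * M * V ^ 3 / cmod z ^ 3" by simp
    also have "\<dots> = C * exp (2 * cmod s) * cmod \<phi> / cmod z ^ 2"
      using z0 by (simp add: M_def C_def power3_eq_cube power2_eq_square)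
    finally show ?thesis by (simp add: \<phi>_def)
  qed
  thus ?thesis using that C by blast
qed

lemma eis_term_locally_dominated:
  assumes "Im \<tau> > 0"
  shows "locally_dominated (period_lattice \<tau>) {s. 1 - real j / 2 < Re s} (\<lambda>w s. eis_term j s (\<alpha> + w))"
  using period_lattice_locally_dominated[OF assms, where k = 0 and j = j and \<alpha> = \<alpha> and f = "\<lambda>w s. eis_term j s (\<alpha> + w)"]
  by (simp add: exI[of _ 1])

text \<open>A linear weight costs one power of decay and moves the boundary to the right by
  1/2.\<close>

lemma eis_weighted_locally_dominated:
  assumes \<tau>: "Im \<tau> > 0" and p: "\<And>z. \<bar>p z\<bar> \<le> K * cmod z"
  shows "locally_dominated (period_lattice \<tau>) {s. 3 / 2 - real j / 2 < Re s}
           (\<lambda>w s. of_real (p (\<alpha> + w)) * eis_term j s (\<alpha> + w))"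
proof -
  have "cmod (of_real (p z) * eis_term j s z) \<le> K * cmod (eis_term j s z) * cmod z powr - (-1)" for s z
    using mult_right_mono[OF p[of z], of "cmod (eis_term j s z)"] by (simp add: norm_mult mult_ac)
  hence "locally_dominated (period_lattice \<tau>) {s. 1 - (real j + (-1)) / 2 < Re s}
           (\<lambda>w s. of_real (p (\<alpha> + w)) * eis_term j s (\<alpha> + w))"
    by (intro period_lattice_locally_dominated[OF \<tau>]) blast
  also have "1 - (real j + (-1)) / 2 = 3 / 2 - real j / 2" by (simp add: field_simps)
  finally show ?thesis .
qed

lemma eis_reg_locally_dominated:
  assumes \<tau>: "Im \<tau> > 0" and j: "j \<ge> 1"
  shows "locally_dominated (period_lattice \<tau>) {s. - real j / 2 < Re s} (\<lambda>w s. eis_reg \<tau> j s (\<alpha> + w))"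
proof -
  obtain C R where C: "C \<ge> 0" "\<And>s z. cmod z \<ge> R \<Longrightarrow>
    cmod (eis_reg \<tau> j s z) \<le> C * exp (2 * cmod s) * cmod (eis_term j s z) / cmod z ^ 2"
    using eis_reg_bound[OF \<tau> j] by metis
  have bound: "cmod (eis_reg \<tau> j s z) \<le> C * exp (2 * S) * cmod (eis_term j s z) * cmod z powr - 2"
    if "cmod z \<ge> max R 1" "cmod s \<le> S" for s z S
  proof -
    have z: "cmod z > 0" using that by linarith
    have "cmod (eis_reg \<tau> j s z) \<le> C * exp (2 * cmod s) * cmod (eis_term j s z) / cmod z ^ 2"
      using that C by auto
    also have "\<dots> = C * exp (2 * cmod s) * cmod (eis_term j s z) * cmod z powr - 2"
      using z by (simp add: powr_minus divide_inverse)
    also have "\<dots> \<le> C * exp (2 * S) * cmod (eis_term j s z) * cmod z powr - 2"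
      using that C by (intro mult_right_mono mult_left_mono) auto
    finally show ?thesis .
  qed
  have "locally_dominated (period_lattice \<tau>) {s. 1 - (real j + 2) / 2 < Re s} (\<lambda>w s. eis_reg \<tau> j s (\<alpha> + w))"
    by (intro period_lattice_locally_dominated[OF \<tau>]) (use bound in blast)
  also have "1 - (real j + 2) / 2 = - real j / 2" by (simp add: field_simps)
  finally show ?thesis .
qed

lemma open_connected_right_half_plane: "open {s. c < Re s}" "connected {s. c < Re s}"
  by (auto simp: open_halfspace_Re_gt convex_halfspace_Re_gt intro: convex_connected)

text \<open>In this smaller half-plane the weighted terms are themselves summable. Each correction
  is then a difference of two translates of one summable function and sums to 0.\<close>

lemma infsum_eis_reg_far:
  assumes \<tau>: "Im \<tau> > 0" and s: "3 / 2 - real j / 2 < Re s"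
  shows "(\<Sum>\<^sub>\<infinity>w\<in>period_lattice \<tau>. eis_reg \<tau> j s (\<alpha> + w)) = (\<Sum>\<^sub>\<infinity>w\<in>period_lattice \<tau>. eis_term j s (\<alpha> + w))"
proof -
  let ?L = "period_lattice \<tau>"
  obtain K where K: "K > 0" "\<And>z. \<bar>rot_fst \<tau> z\<bar> \<le> K * cmod z" "\<And>z. \<bar>rot_snd \<tau> z\<bar> \<le> K * cmod z"
    using rot_bound[OF \<tau>] by metis
  have diff: "((\<lambda>w. of_real (p (\<alpha> + w + v)) * eis_term j s (\<alpha> + w + v)
                 - of_real (p (\<alpha> + w - v)) * eis_term j s (\<alpha> + w - v)) has_sum 0) ?L"
    if p: "\<And>z. \<bar>p z\<bar> \<le> K * cmod z" and v: "v \<in> ?L" for p :: "complex \<Rightarrow> real" and v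
  proof -
    define g where "g = (\<lambda>w. of_real (p (\<alpha> + w)) * eis_term j s (\<alpha> + w))"
    have g: "(g has_sum infsum g ?L) ?L"
      unfolding g_def
      by (intro has_sum_infsum locally_dominated_summable[OF eis_weighted_locally_dominated[OF \<tau> p]]) (use s in auto)
    have "((\<lambda>w. g (w + u)) has_sum infsum g ?L) ?L" if "u \<in> ?L" for u
      using g has_sum_reindex_bij_betw[OF bij_betw_period_lattice_shift[OF that], of g] by simp
    from has_sum_diff[OF this[of v] this[of "-v"]] show ?thesis
      using v by (simp add: g_def algebra_simps)
  qed
  have "((\<lambda>w. eis_reg \<tau> j s (\<alpha> + w)) has_sum
          ((\<Sum>\<^sub>\<infinity>w\<in>?L. eis_term j s (\<alpha> + w)) + 1 / (2 * \<i> * of_nat j) * (0 + 0))) ?L"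
    unfolding eis_reg_def
    by (intro has_sum_add has_sum_cmult_right diff K has_sum_infsum
          locally_dominated_summable[OF eis_term_locally_dominated[OF \<tau>]]) (use s in auto)
  thus ?thesis by (simp add: infsumI)
qed

text \<open>The corrections can no longer be summed separately this close to the boundary, so the
  equality is carried over by the identity theorem from the half-plane
  \<open>Re s > 3/2 - j/2\<close>.\<close>

lemma infsum_eis_reg:
  assumes \<tau>: "Im \<tau> > 0" and j: "j \<ge> 1" and s: "1 - real j / 2 < Re s"
  shows "(\<Sum>\<^sub>\<infinity>w\<in>period_lattice \<tau>. eis_reg \<tau> j s (\<alpha> + w)) = (\<Sum>\<^sub>\<infinity>w\<in>period_lattice \<tau>. eis_term j s (\<alpha> + w))"
proof (rule analytic_continuation_open[where f = "\<lambda>s. \<Sum>\<^sub>\<infinity>w\<in>period_lattice \<tau>. eis_reg \<tau> j s (\<alpha> + w)"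
    and g = "\<lambda>s. \<Sum>\<^sub>\<infinity>w\<in>period_lattice \<tau>. eis_term j s (\<alpha> + w)" and z = s and s = "{s. 3 / 2 - real j / 2 < Re s}" and s' = "{s. 1 - real j / 2 < Re s}"])
  show "{s. 3 / 2 - real j / 2 < Re s} \<noteq> {}"
    by (auto intro!: exI[of _ "of_real 2"])
  have "(\<lambda>s. \<Sum>\<^sub>\<infinity>w\<in>period_lattice \<tau>. eis_reg \<tau> j s (\<alpha> + w)) holomorphic_on {s. - real j / 2 < Re s}"
    by (rule locally_dominated_holomorphic[OF eis_reg_locally_dominated[OF \<tau> j]])
       (auto intro!: open_connected_right_half_plane holomorphic_intros)
  thus "(\<lambda>s. \<Sum>\<^sub>\<infinity>w\<in>period_lattice \<tau>. eis_reg \<tau> j s (\<alpha> + w)) holomorphic_on {s. 1 - real j / 2 < Re s}"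
    by (rule holomorphic_on_subset) auto
  show "(\<lambda>s. \<Sum>\<^sub>\<infinity>w\<in>period_lattice \<tau>. eis_term j s (\<alpha> + w)) holomorphic_on {s. 1 - real j / 2 < Re s}"
    by (rule locally_dominated_holomorphic[OF eis_term_locally_dominated[OF \<tau>]])
       (auto intro!: open_connected_right_half_plane holomorphic_intros)
qed (use infsum_eis_reg_far[OF \<tau>] s in \<open>auto intro!: open_connected_right_half_plane\<close>)

lemma eisenstein_series_eq:
  assumes "j \<ge> 1"
  shows "eisenstein_series \<tau> j \<alpha> s = (\<Sum>\<^sub>\<infinity>w\<in>period_lattice \<tau>. eis_term j s (\<alpha> + w))"
  unfolding eisenstein_series_def eis_term_def
  by (rule infsum_cong_neutral) (use assms in \<open>auto simp: add_eq_0_iff\<close>)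

text \<open>The sum of \<open>eis_reg\<close> is holomorphic for \<open>Re s > - j / 2\<close>, a
  half-plane containing 0 because \<open>j \<ge> 1\<close>; it is the witness for the definite
  description, and the identity theorem rules out any other value.\<close>

lemma eisenstein_E_eq:
  assumes \<tau>: "Im \<tau> > 0" and j: "j \<ge> 1"
  shows "eisenstein_E j \<tau> \<alpha> = (\<Sum>\<^sub>\<infinity>w\<in>period_lattice \<tau>. eis_reg \<tau> j 0 (\<alpha> + w))"
proof -
  define F where "F = (\<lambda>s. \<Sum>\<^sub>\<infinity>w\<in>period_lattice \<tau>. eis_reg \<tau> j s (\<alpha> + w))"
  have F_holo: "F holomorphic_on {s. - real j / 2 < Re s}"
    unfolding F_def by (rule locally_dominated_holomorphic[OF eis_reg_locally_dominated[OF \<tau> j]])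
       (auto intro!: open_connected_right_half_plane holomorphic_intros)
  have F_eq: "F s = eisenstein_series \<tau> j \<alpha> s" if "1 - real j / 2 < Re s" for s
    unfolding F_def eisenstein_series_eq[OF j] by (rule infsum_eis_reg[OF \<tau> j that])
  show ?thesis
    unfolding eisenstein_E_def
  proof (rule the_equality)
    show "\<exists>F c. c < 0 \<and> F holomorphic_on {s. c < Re s} \<and>
        (\<forall>s. 1 - real j / 2 < Re s \<longrightarrow> F s = eisenstein_series \<tau> j \<alpha> s) \<and>
        (\<Sum>\<^sub>\<infinity>w\<in>period_lattice \<tau>. eis_reg \<tau> j 0 (\<alpha> + w)) = F 0"
      by (rule exI[of _ F], rule exI[of _ "- real j / 2"]) (use F_holo F_eq j in \<open>auto simp: F_def\<close>)
  next
    fix v assume "\<exists>F c. c < 0 \<and> F holomorphic_on {s. c < Re s} \<and>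
        (\<forall>s. 1 - real j / 2 < Re s \<longrightarrow> F s = eisenstein_series \<tau> j \<alpha> s) \<and> v = F 0"
    then obtain G c where G: "c < 0" "G holomorphic_on {s. c < Re s}"
      "\<And>s. 1 - real j / 2 < Re s \<Longrightarrow> G s = eisenstein_series \<tau> j \<alpha> s" "v = G 0" by blast
    \<comment> \<open>The competitor \<open>G\<close> has its own half-plane. The common half-plane
      bounded by \<open>c'\<close> still contains 0, is connected, and meets the region where both
      functions are the series.\<close>
    define c' where "c' = max c (- real j / 2)"
    have "G 0 = F 0"
    proof (rule analytic_continuation_open[where f = G and g = F and z = 0 and s = "{s. max c' (1 - real j / 2) < Re s}" and s' = "{s. c' < Re s}"])
      show "{s. max c' (1 - real j / 2) < Re s} \<noteq> {}"
        by (auto intro!: exI[of _ "of_real (max c' (1 - real j / 2) + 1)"])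
      show "G holomorphic_on {s. c' < Re s}" "F holomorphic_on {s. c' < Re s}"
        using G(2) F_holo by (auto elim!: holomorphic_on_subset simp: c'_def)
      show "open {s. max c' (1 - real j / 2) < Re s}" "open {s. c' < Re s}" "connected {s. c' < Re s}"
        by (rule open_connected_right_half_plane)+
    qed (use G(1,3) F_eq j in \<open>auto simp: c'_def\<close>)
    thus "v = (\<Sum>\<^sub>\<infinity>w\<in>period_lattice \<tau>. eis_reg \<tau> j 0 (\<alpha> + w))" using G(4) by (simp add: F_def)
  qed
qed

text \<open>The regularized sum converges at \<open>s = 0\<close> over the whole lattice, so
  translation invariance is a reindexing, also for \<open>j = 1\<close> and
  \<open>j = 2\<close>.\<close>

lemma eisenstein_E_periodic:
  assumes "Im \<tau> > 0" "j \<ge> 1" "\<omega> \<in> period_lattice \<tau>"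
  shows "eisenstein_E j \<tau> (\<alpha> + \<omega>) = eisenstein_E j \<tau> \<alpha>"
  using infsum_period_lattice_shift[OF assms(3), of "\<lambda>w. eis_reg \<tau> j 0 (\<alpha> + w)"]
  by (simp add: eisenstein_E_eq[OF assms(1,2)] add_ac)

section \<open>Balanced combinations of Eisenstein terms\<close>

text \<open>In the expansion of \<open>eis_term\<close> about \<open>z\<close>, the constant terms
  carry the factor \<open>\<Sum>c\<close> and the first order terms are combinations of
  \<open>\<Sum>c \<alpha>\<close> and \<open>\<Sum>c cnj \<alpha>\<close>, since the function is not
  holomorphic in \<open>z\<close>. All three sums vanish and the second order remainders are
  left.\<close>

lemma eis_term_balanced_bound:
  fixes c :: "'a \<Rightarrow> complex" and \<alpha> :: "'a \<Rightarrow> complex"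
  assumes I: "finite I" and c0: "(\<Sum>i\<in>I. c i) = 0" and c1: "(\<Sum>i\<in>I. c i * \<alpha> i) = 0"
    and c2: "(\<Sum>i\<in>I. c i * cnj (\<alpha> i)) = 0"
  obtains C R where "C \<ge> 0" "\<And>s z. cmod z \<ge> R \<Longrightarrow>
    cmod (\<Sum>i\<in>I. c i * eis_term j s (\<alpha> i + z)) \<le> C * exp (2 * cmod s) * cmod (eis_term j s z) / cmod z ^ 2"
proof -
  \<comment> \<open>A common bound for all shifts; the summand 1 keeps it positive when every shift
    is 0.\<close>
  define V where "V = 1 + (\<Sum>i\<in>I. cmod (\<alpha> i))"
  have V: "V > 0" by (simp add: V_def add_pos_nonneg sum_nonneg)
  have \<alpha>V: "cmod (\<alpha> i) \<le> V" if "i \<in> I" for i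
    using member_le_sum[OF that, of "\<lambda>i. cmod (\<alpha> i)"] I by (simp add: V_def)
  define C where "C = (\<Sum>i\<in>I. cmod (c i)) * (512 * 2 ^ j * V ^ 2)"
  have C: "C \<ge> 0" using V by (simp add: C_def sum_nonneg)
  have "cmod (\<Sum>i\<in>I. c i * eis_term j s (\<alpha> i + z)) \<le> C * exp (2 * cmod s) * cmod (eis_term j s z) / cmod z ^ 2"
    if z: "cmod z \<ge> 4 * V" for s z
  proof -
    define \<phi> where "\<phi> = eis_term j s z"
    define d where "d = (\<lambda>i. \<phi> * (0 - 1 * (of_nat j * (\<alpha> i / z) + s * (\<alpha> i / z + cnj (\<alpha> i / z)))))"
    define B where "B = 512 * (1 * 2 ^ j * exp (2 * cmod s) * cmod \<phi>) * V ^ 2 / cmod z ^ 2"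
    have D: "cmod ((1 + 0) * eis_term j s (z + \<alpha> i) - 1 * eis_term j s z - d i) \<le> B" if "i \<in> I" for i
      unfolding d_def \<phi>_def B_def by (rule eis_term_diff2) (use V z \<alpha>V[OF that] in auto)
    have "(\<Sum>i\<in>I. c i * d i) = - \<phi> * (of_nat j * ((\<Sum>i\<in>I. c i * \<alpha> i) / z) +
            s * ((\<Sum>i\<in>I. c i * \<alpha> i) / z + (\<Sum>i\<in>I. c i * cnj (\<alpha> i)) / cnj z))"
      by (simp add: d_def sum_distrib_left sum_divide_distrib sum.distrib sum_subtractf sum_negf algebra_simps)
    hence "(\<Sum>i\<in>I. c i * d i) = 0" by (simp add: c1 c2)
    moreover have "(\<Sum>i\<in>I. c i * \<phi>) = 0" using c0 by (simp add: sum_distrib_right[symmetric])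
    ultimately have "(\<Sum>i\<in>I. c i * eis_term j s (\<alpha> i + z)) =
        (\<Sum>i\<in>I. c i * ((1 + 0) * eis_term j s (z + \<alpha> i) - 1 * eis_term j s z - d i))"
      by (simp add: algebra_simps sum.distrib sum_subtractf \<phi>_def)
    also have "cmod \<dots> \<le> (\<Sum>i\<in>I. cmod (c i) * B)"
      using D by (intro sum_norm_le) (auto simp: norm_mult intro!: mult_left_mono)
    also have "\<dots> = C * exp (2 * cmod s) * cmod \<phi> / cmod z ^ 2"
      by (simp add: B_def C_def sum_distrib_right[symmetric] sum_divide_distrib[symmetric])
    finally show ?thesis by (simp add: \<phi>_def)
  qed
  thus ?thesis using that C by blast
qed

lemma eis_balanced_locally_dominated:
  fixes c :: "'a \<Rightarrow> complex" and \<alpha> :: "'a \<Rightarrow> complex"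
  assumes \<tau>: "Im \<tau> > 0" and I: "finite I" and c0: "(\<Sum>i\<in>I. c i) = 0" and c1: "(\<Sum>i\<in>I. c i * \<alpha> i) = 0"
    and c2: "(\<Sum>i\<in>I. c i * cnj (\<alpha> i)) = 0"
  shows "locally_dominated (period_lattice \<tau>) {s. - real j / 2 < Re s}
           (\<lambda>w s. \<Sum>i\<in>I. c i * eis_term j s (\<alpha> i + w))"
proof -
  obtain C R where C: "C \<ge> 0" "\<And>s z. cmod z \<ge> R \<Longrightarrow>
    cmod (\<Sum>i\<in>I. c i * eis_term j s (\<alpha> i + z)) \<le> C * exp (2 * cmod s) * cmod (eis_term j s z) / cmod z ^ 2"
    using eis_term_balanced_bound[OF I c0 c1 c2] by metis
  have bound: "cmod (\<Sum>i\<in>I. c i * eis_term j s (\<alpha> i + z)) \<le> C * exp (2 * S) * cmod (eis_term j s (0 + z)) * cmod (0 + z) powr - 2"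
    if "cmod (0 + z) \<ge> max R 1" "cmod s \<le> S" for s z S
  proof -
    have z: "cmod z > 0" using that by auto
    have "cmod (\<Sum>i\<in>I. c i * eis_term j s (\<alpha> i + z)) \<le> C * exp (2 * cmod s) * cmod (eis_term j s z) / cmod z ^ 2"
      using that C by auto
    also have "\<dots> = C * exp (2 * cmod s) * cmod (eis_term j s z) * cmod z powr - 2"
      using z by (simp add: powr_minus divide_inverse)
    also have "\<dots> \<le> C * exp (2 * S) * cmod (eis_term j s z) * cmod z powr - 2"
      using that C by (intro mult_right_mono mult_left_mono) auto
    finally show ?thesis by simp
  qed
  have "locally_dominated (period_lattice \<tau>) {s. 1 - (real j + 2) / 2 < Re s}
          (\<lambda>w s. \<Sum>i\<in>I. c i * eis_term j s (\<alpha> i + w))"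
    by (intro period_lattice_locally_dominated[OF \<tau>, where \<alpha> = 0]) (use bound in blast)
  also have "1 - (real j + 2) / 2 = - real j / 2" by (simp add: field_simps)
  finally show ?thesis .
qed

text \<open>Both sides are the values at \<open>s = 0\<close> of continuations of the same series.\<close>

lemma sum_eisenstein_E:
  fixes c :: "'a \<Rightarrow> complex" and \<alpha> :: "'a \<Rightarrow> complex"
  assumes \<tau>: "Im \<tau> > 0" and j: "j \<ge> 1" and I: "finite I" and c0: "(\<Sum>i\<in>I. c i) = 0"
    and c1: "(\<Sum>i\<in>I. c i * \<alpha> i) = 0" and c2: "(\<Sum>i\<in>I. c i * cnj (\<alpha> i)) = 0"
  shows "(\<Sum>i\<in>I. c i * eisenstein_E j \<tau> (\<alpha> i)) = (\<Sum>\<^sub>\<infinity>w\<in>period_lattice \<tau>. \<Sum>i\<in>I. c i / (\<alpha> i + w) ^ j)"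
proof -
  let ?L = "period_lattice \<tau>"
  define F where "F = (\<lambda>s. \<Sum>i\<in>I. c i * (\<Sum>\<^sub>\<infinity>w\<in>?L. eis_reg \<tau> j s (\<alpha> i + w)))"
  define G where "G = (\<lambda>s. \<Sum>\<^sub>\<infinity>w\<in>?L. \<Sum>i\<in>I. c i * eis_term j s (\<alpha> i + w))"
  have "F 0 = G 0"
  proof (rule analytic_continuation_open[where f = F and g = G and z = 0 and s = "{s. 1 - real j / 2 < Re s}" and s' = "{s. - real j / 2 < Re s}"])
    show "{s. 1 - real j / 2 < Re s} \<noteq> {}"
      by (auto intro!: exI[of _ "of_real 2"])
    show "F holomorphic_on {s. - real j / 2 < Re s}"
      unfolding F_def
      by (intro holomorphic_intros locally_dominated_holomorphic[OF eis_reg_locally_dominated[OF \<tau> j]]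
            open_connected_right_half_plane)
    show "G holomorphic_on {s. - real j / 2 < Re s}"
      unfolding G_def
      by (intro holomorphic_intros open_connected_right_half_plane
            locally_dominated_holomorphic[OF eis_balanced_locally_dominated[OF \<tau> I c0 c1 c2]])
    fix s assume "s \<in> {s. 1 - real j / 2 < Re s}"
    hence s: "1 - real j / 2 < Re s" by simp
    have "((\<lambda>w. \<Sum>i\<in>I. c i * eis_term j s (\<alpha> i + w)) has_sum
            (\<Sum>i\<in>I. c i * (\<Sum>\<^sub>\<infinity>w\<in>?L. eis_term j s (\<alpha> i + w)))) ?L"
      by (intro has_sum_sum has_sum_cmult_right has_sum_infsum
            locally_dominated_summable[OF eis_term_locally_dominated[OF \<tau>]]) (use s I in auto)
    thus "F s = G s" by (simp add: F_def G_def infsum_eis_reg[OF \<tau> j s] infsumI)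
  qed (use j in \<open>auto intro!: open_connected_right_half_plane\<close>)
  thus ?thesis by (simp add: F_def G_def eisenstein_E_eq[OF \<tau> j] eis_term_at_0[OF j])
qed

lemma abs_summable_balanced:
  fixes c :: "'a \<Rightarrow> complex" and \<alpha> :: "'a \<Rightarrow> complex"
  assumes \<tau>: "Im \<tau> > 0" and j: "j \<ge> 1" and I: "finite I" and c0: "(\<Sum>i\<in>I. c i) = 0"
    and c1: "(\<Sum>i\<in>I. c i * \<alpha> i) = 0" and c2: "(\<Sum>i\<in>I. c i * cnj (\<alpha> i)) = 0"
  shows "(\<lambda>w. norm (\<Sum>i\<in>I. c i / (\<alpha> i + w) ^ j)) summable_on period_lattice \<tau>"
  using locally_dominated_abs_summable[OF eis_balanced_locally_dominated[OF \<tau> I c0 c1 c2], of 0 j] j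
  by (simp add: eis_term_at_0[OF j])

section \<open>The Weierstrass zeta and sigma functions\<close>

text \<open>With \<open>1 / 0 = 0\<close> the index \<open>\<omega> = 0\<close> yields the isolated
  summand \<open>1 / z\<close>, so \<open>weierstrass_zeta\<close> becomes one sum over the full
  lattice.\<close>

definition zeta_term :: "complex \<Rightarrow> complex \<Rightarrow> complex" where
  "zeta_term \<omega> z = 1 / (z - \<omega>) + 1 / \<omega> + z / \<omega>\<^sup>2"

lemma zeta_term_0 [simp]: "zeta_term 0 z = 1 / z"
  by (simp add: zeta_term_def)

lemma zeta_term_eq: "\<omega> \<noteq> 0 \<Longrightarrow> z \<noteq> \<omega> \<Longrightarrow> zeta_term \<omega> z = z\<^sup>2 / (\<omega>\<^sup>2 * (z - \<omega>))"
  by (simp add: zeta_term_def divide_simps) (simp add: algebra_simps power2_eq_square power3_eq_cube)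

text \<open>The three summands combine to
  \<open>z\<^sup>2 / (\<omega>\<^sup>2 (z - \<omega>))\<close>, of order
  \<open>|\<omega>|^-3\<close>. \<open>A\<close> may contain periods: the finitely many \<omega>
  that are close to the disc are put into \<open>K\<close>.\<close>

lemma zeta_term_locally_dominated:
  assumes \<tau>: "Im \<tau> > 0"
  shows "locally_dominated (period_lattice \<tau>) A zeta_term"
  unfolding locally_dominated_def
proof
  fix z0
  define \<rho> where "\<rho> = cmod z0 + 1"
  have \<rho>: "\<rho> > 0" by (simp add: \<rho>_def add_nonneg_pos)
  define K where "K = {\<omega> \<in> period_lattice \<tau>. cmod \<omega> \<le> 2 * \<rho>}"
  define g where "g = (\<lambda>\<omega>. 2 * \<rho>\<^sup>2 * cmod \<omega> powr - 3)"
  have "cmod (zeta_term \<omega> z) \<le> g \<omega>" if w: "\<omega> \<in> period_lattice \<tau> - K" and z: "z \<in> cball z0 1" for \<omega> z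
  proof -
    have w: "cmod \<omega> > 2 * \<rho>" using w by (auto simp: K_def)
    have z: "cmod z \<le> \<rho>" using z norm_triangle_sub[of z z0] by (simp add: \<rho>_def dist_norm norm_minus_commute)
    have w0: "cmod \<omega> > 0" using w \<rho> by linarith
    have zw: "cmod (z - \<omega>) \<ge> cmod \<omega> / 2"
      using norm_triangle_ineq2[of \<omega> z] w z by (simp add: norm_minus_commute)
    have "zeta_term \<omega> z = z\<^sup>2 / (\<omega>\<^sup>2 * (z - \<omega>))"
    proof (rule zeta_term_eq)
      show "\<omega> \<noteq> 0" using w0 by auto
      show "z \<noteq> \<omega>" using w z \<rho> by auto
    qed
    also have "cmod \<dots> = (cmod z)\<^sup>2 / ((cmod \<omega>)\<^sup>2 * cmod (z - \<omega>))"
      by (simp add: norm_divide norm_mult norm_power)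
    also have "\<dots> \<le> \<rho>\<^sup>2 / ((cmod \<omega>)\<^sup>2 * (cmod \<omega> / 2))"
      using w0 zw z by (intro frac_le mult_left_mono power_mono) auto
    also have "\<dots> = 2 * \<rho>\<^sup>2 * inverse (cmod \<omega> ^ 3)"
      using w0 by (simp add: eval_nat_numeral field_simps)
    also have "\<dots> = g \<omega>"
      using w0 by (simp add: g_def powr_minus)
    finally show ?thesis .
  qed
  moreover have "g summable_on period_lattice \<tau>"
    unfolding g_def by (intro summable_on_cmult_right summable_on_period_lattice_powr \<tau>) auto
  moreover have "finite K" unfolding K_def by (rule finite_period_lattice_ball[OF \<tau>])
  ultimately show "\<exists>r>0. \<exists>K g. finite K \<and> g summable_on period_lattice \<tau> \<and>
      (\<forall>\<omega>\<in>period_lattice \<tau> - K. \<forall>z\<in>cball z0 r. cmod (zeta_term \<omega> z) \<le> g \<omega>)"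
    by (intro exI[of _ "1::real"] exI[of _ K] exI[of _ g] conjI ballI) simp_all
qed

lemma has_sum_weierstrass_zeta:
  assumes \<tau>: "Im \<tau> > 0"
  shows "((\<lambda>\<omega>. zeta_term \<omega> z) has_sum weierstrass_zeta \<tau> z) (period_lattice \<tau>)"
proof -
  have "(\<lambda>\<omega>. zeta_term \<omega> z) summable_on (period_lattice \<tau> - {0})"
    using locally_dominated_summable[OF zeta_term_locally_dominated[OF \<tau>], of z UNIV]
    by (rule summable_on_subset) auto
  hence "((\<lambda>\<omega>. zeta_term \<omega> z) has_sum (\<Sum>\<^sub>\<infinity>\<omega>\<in>period_lattice \<tau> - {0}. zeta_term \<omega> z)) (period_lattice \<tau> - {0})"
    by (rule has_sum_infsum)
  hence "((\<lambda>\<omega>. zeta_term \<omega> z) has_sum (zeta_term 0 z + (\<Sum>\<^sub>\<infinity>\<omega>\<in>period_lattice \<tau> - {0}. zeta_term \<omega> z)))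
           (insert 0 (period_lattice \<tau> - {0}))"
    by (intro has_sum_insert) auto
  also have "insert 0 (period_lattice \<tau> - {0}) = period_lattice \<tau>" by auto
  also have "zeta_term 0 z + (\<Sum>\<^sub>\<infinity>\<omega>\<in>period_lattice \<tau> - {0}. zeta_term \<omega> z) = weierstrass_zeta \<tau> z"
    unfolding weierstrass_zeta_def zeta_term_def by simp
  finally show ?thesis .
qed

text \<open>In each summand the regularizing parts carry the factors \<open>\<Sum>c\<close> and
  \<open>\<Sum>c p\<close> and disappear. This also holds at \<open>\<omega> = 0\<close> and at
  poles, by the default value of division.\<close>

lemma has_sum_balanced_zeta:
  fixes c p :: "'a \<Rightarrow> complex"
  assumes \<tau>: "Im \<tau> > 0" and I: "finite I" and c0: "(\<Sum>i\<in>I. c i) = 0" and c1: "(\<Sum>i\<in>I. c i * p i) = 0"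
  shows "((\<lambda>\<omega>. \<Sum>i\<in>I. c i / (p i - \<omega>)) has_sum (\<Sum>i\<in>I. c i * weierstrass_zeta \<tau> (p i))) (period_lattice \<tau>)"
proof -
  have "((\<lambda>\<omega>. \<Sum>i\<in>I. c i * zeta_term \<omega> (p i)) has_sum (\<Sum>i\<in>I. c i * weierstrass_zeta \<tau> (p i))) (period_lattice \<tau>)"
    by (intro has_sum_sum I has_sum_cmult_right has_sum_weierstrass_zeta \<tau>)
  also have "(\<lambda>\<omega>. \<Sum>i\<in>I. c i * zeta_term \<omega> (p i)) = (\<lambda>\<omega>. \<Sum>i\<in>I. c i / (p i - \<omega>))"
  proof
    fix \<omega>
    have "(\<Sum>i\<in>I. c i * zeta_term \<omega> (p i)) =
            (\<Sum>i\<in>I. c i / (p i - \<omega>)) + (\<Sum>i\<in>I. c i) / \<omega> + (\<Sum>i\<in>I. c i * p i) / \<omega>\<^sup>2"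
      by (simp add: zeta_term_def ring_distribs sum.distrib sum_divide_distrib)
    thus "(\<Sum>i\<in>I. c i * zeta_term \<omega> (p i)) = (\<Sum>i\<in>I. c i / (p i - \<omega>))" by (simp add: c0 c1)
  qed
  finally show ?thesis .
qed

lemma balanced_zeta_eq_eisenstein_E:
  fixes c p :: "'a \<Rightarrow> complex"
  assumes \<tau>: "Im \<tau> > 0" and I: "finite I" and c0: "(\<Sum>i\<in>I. c i) = 0" and c1: "(\<Sum>i\<in>I. c i * p i) = 0"
    and c2: "(\<Sum>i\<in>I. c i * cnj (p i)) = 0"
  shows "(\<Sum>i\<in>I. c i * weierstrass_zeta \<tau> (p i)) = (\<Sum>i\<in>I. c i * eisenstein_E 1 \<tau> (p i))"
proof -
  have "(\<Sum>i\<in>I. c i * weierstrass_zeta \<tau> (p i)) = (\<Sum>\<^sub>\<infinity>\<omega>\<in>period_lattice \<tau>. \<Sum>i\<in>I. c i / (p i - \<omega>))"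
    using has_sum_balanced_zeta[OF \<tau> I c0 c1] by (simp add: infsumI)
  also have "\<dots> = (\<Sum>\<^sub>\<infinity>\<omega>\<in>period_lattice \<tau>. \<Sum>i\<in>I. c i / (p i + \<omega>) ^ 1)"
    using infsum_period_lattice_uminus[of "\<lambda>\<omega>. \<Sum>i\<in>I. c i / (p i + \<omega>)" \<tau>] by simp
  also have "\<dots> = (\<Sum>i\<in>I. c i * eisenstein_E 1 \<tau> (p i))"
    by (rule sum_eisenstein_E[OF \<tau> _ I c0 c1 c2, symmetric]) auto
  finally show ?thesis .
qed

text \<open>The divisor \<open>(z + \<omega>) - (z) - (u + \<omega>) + (u)\<close> is balanced, and \<open>E\<^sub>1\<close> is periodic.\<close>

lemma weierstrass_zeta_quasiperiodic:
  assumes \<tau>: "Im \<tau> > 0" and \<omega>: "\<omega> \<in> period_lattice \<tau>"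
  obtains \<eta> where "\<And>z. weierstrass_zeta \<tau> (z + \<omega>) = weierstrass_zeta \<tau> z + \<eta>"
proof -
  have diff: "weierstrass_zeta \<tau> (z + \<omega>) - weierstrass_zeta \<tau> z = weierstrass_zeta \<tau> (u + \<omega>) - weierstrass_zeta \<tau> u" for z u
  proof -
    \<comment> \<open>An indexed family rather than a set of points, since the four points may
      coincide.\<close>
    define c :: "nat \<Rightarrow> complex" where "c = (\<lambda>i. [1, -1, -1, 1] ! i)"
    define p where "p = (\<lambda>i. [z + \<omega>, z, u + \<omega>, u] ! i)"
    have sum4: "(\<Sum>i<4. f i) = f 0 + f 1 + f 2 + f 3" for f :: "nat \<Rightarrow> complex"
      by (simp add: eval_nat_numeral)
    have "(\<Sum>i<4. c i * weierstrass_zeta \<tau> (p i)) = (\<Sum>i<4. c i * eisenstein_E 1 \<tau> (p i))"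
      by (rule balanced_zeta_eq_eisenstein_E[OF \<tau>]) (simp_all add: sum4, simp_all add: c_def p_def)
    also have "\<dots> = 0"
      by (simp add: sum4) (simp add: c_def p_def eisenstein_E_periodic[OF \<tau> _ \<omega>])
    finally show ?thesis by (simp add: sum4) (simp add: c_def p_def algebra_simps)
  qed
  \<comment> \<open>The base point 0 is legitimate although it is a pole: with
    \<open>1 / 0 = 0\<close> the zeta sum and the Eisenstein sum drop the same singular term, so
    \<open>diff\<close> holds at all points.\<close>
  have "weierstrass_zeta \<tau> (z + \<omega>) = weierstrass_zeta \<tau> z + (weierstrass_zeta \<tau> (0 + \<omega>) - weierstrass_zeta \<tau> 0)" for z
    using diff[of z 0] by (simp add: algebra_simps)
  thus ?thesis by (rule that)
qed

section \<open>The sigma function as a Weierstrass product\<close>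

lemma countable_period_lattice: "countable (period_lattice \<tau>)"
proof -
  have "period_lattice \<tau> = range (\<lambda>(a::int, b::int). of_int a + of_int b * \<tau>)"
    by (auto simp: period_lattice_def image_iff)
  thus ?thesis by simp
qed

lemma infinite_period_lattice: "infinite (period_lattice \<tau>)"
proof
  assume "finite (period_lattice \<tau>)"
  moreover have "range (of_int :: int \<Rightarrow> complex) \<subseteq> period_lattice \<tau>"
    using period_latticeI[of _ 0 \<tau>] by auto
  ultimately have "finite (range (of_int :: int \<Rightarrow> complex))" by (rule rev_finite_subset)
  hence "finite (UNIV :: int set)" by (rule finite_imageD) (auto simp: inj_on_def)
  thus False by simp
qed

lemma closed_period_lattice:
  assumes "Im \<tau> > 0"
  shows "closed (period_lattice \<tau>)"
proof -
  have "\<not> x islimpt period_lattice \<tau>" for x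
  proof
    assume "x islimpt period_lattice \<tau>"
    hence "infinite (period_lattice \<tau> \<inter> ball x 1)" by (simp add: islimpt_eq_infinite_ball)
    moreover have "period_lattice \<tau> \<inter> ball x 1 \<subseteq> {\<omega> \<in> period_lattice \<tau>. cmod (- x + \<omega>) \<le> 1}"
      by (auto simp: dist_norm norm_minus_commute)
    ultimately show False
      using finite_period_lattice_ball_shifted[OF assms, of "-x" 1] finite_subset by blast
  qed
  thus ?thesis by (simp add: closed_limpt)
qed

text \<open>The product over nonzero periods of the factors
  \<open>(1 - u) exp (u + u\<^sup>2 / 2)\<close> with \<open>u = z / \<omega>\<close>, times
  \<open>z\<close>. Genus 2 is right because the sum of \<open>|\<omega>|^-3\<close> converges, and
  the logarithmic derivative of such a factor is exactly
  \<open>zeta_term \<omega> z\<close>.\<close>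

lemma weierstrass_sigma_exists:
  assumes \<tau>: "Im \<tau> > 0"
  obtains \<sigma> where "\<sigma> holomorphic_on UNIV" "\<And>z. \<sigma> z = 0 \<longleftrightarrow> z \<in> period_lattice \<tau>"
    "\<And>z. z \<in> period_lattice \<tau> \<Longrightarrow> zorder \<sigma> z = 1"
    "\<And>z. z \<notin> period_lattice \<tau> \<Longrightarrow> deriv \<sigma> z = weierstrass_zeta \<tau> z * \<sigma> z"
proof -
  define L' where "L' = period_lattice \<tau> - {0}"
  \<comment> \<open>The product is indexed by natural numbers. Any enumeration will do: the
    unordered zeta sum determines the sequential one, and injectivity makes all zeros
    simple.\<close>
  define a where "a = from_nat_into L'"
  have a: "bij_betw a UNIV L'"
    unfolding a_def L'_def
    by (rule bij_betw_from_nat_into)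
       (use infinite_remove[OF infinite_period_lattice] in \<open>auto intro: countable_period_lattice\<close>)
  hence inj: "inj a" and range: "range a = L'" by (auto simp: bij_betw_def)
  interpret weierstrass_product a "\<lambda>_. 2"
  proof
    show "a n \<noteq> 0" for n using range by (auto simp: L'_def)
    show "filterlim a at_infinity at_top"
      unfolding filterlim_at_infinity_conv_norm_at_top filterlim_at_top_gt[where c = 0]
    proof (intro allI impI)
      fix R :: real
      have "finite (a -` {\<omega> \<in> period_lattice \<tau>. cmod \<omega> \<le> R})"
        by (rule finite_vimageI[OF finite_period_lattice_ball[OF \<tau>] inj])
      moreover have "{n. \<not> R \<le> cmod (a n)} \<subseteq> a -` {\<omega> \<in> period_lattice \<tau>. cmod \<omega> \<le> R}"
        using range by (auto simp: L'_def)
      ultimately have "finite {n. \<not> R \<le> cmod (a n)}" by (rule rev_finite_subset)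
      thus "eventually (\<lambda>n. R \<le> cmod (a n)) sequentially"
        unfolding cofinite_eq_sequentially[symmetric] eventually_cofinite .
    qed
    fix r :: real assume r: "r > 0"
    have "(\<lambda>\<omega>. cmod \<omega> powr - 3) summable_on L'"
      using summable_on_period_lattice_powr[OF \<tau>, of 3] by (rule summable_on_subset) (auto simp: L'_def)
    hence "(\<lambda>n. cmod (a n) powr - 3) summable_on UNIV"
      using summable_on_reindex_bij_betw[OF a, of "\<lambda>\<omega>. cmod \<omega> powr - 3"] by simp
    hence "summable (\<lambda>n. r ^ 3 * (cmod (a n) powr - 3))"
      by (intro summable_mult summable_on_imp_summable)
    also have "(\<lambda>n. r ^ 3 * (cmod (a n) powr - 3)) = (\<lambda>n. (r / norm (a n)) ^ Suc 2)"
    proof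
      fix n
      have "a n \<noteq> 0" using range by (auto simp: L'_def)
      thus "r ^ 3 * (cmod (a n) powr - 3) = (r / norm (a n)) ^ Suc 2"
        by (simp add: powr_minus divide_inverse power_mult_distrib power_inverse)
    qed
    finally show "summable (\<lambda>n. (r / norm (a n)) ^ Suc 2)" .
  qed
  have a_nz: "a n \<noteq> 0" for n using range by (auto simp: L'_def)
  define \<sigma> where "\<sigma> = (\<lambda>z. z * f z)"
  have f_holo: "f holomorphic_on A" for A by (rule holomorphic)
  have f_zero: "f z = 0 \<longleftrightarrow> z \<in> L'" for z using zero[of z] range by simp
  have logderiv: "deriv f z / f z = weierstrass_zeta \<tau> z - 1 / z" if z: "z \<notin> period_lattice \<tau>" for z
  proof -
    define R where "R = cmod z + 1"
    have R: "R > 0" by (simp add: R_def add_nonneg_pos)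
    have "uniform_limit (ball 0 R) (\<lambda>N z. \<Prod>n<N. weierstrass_factor 2 (z / a n)) f sequentially"
      by (rule uniform_limit_on_subset[OF uniform_limit[OF R]]) auto
    hence "(\<lambda>n. deriv (\<lambda>z. weierstrass_factor 2 (z / a n)) z / weierstrass_factor 2 (z / a n)) sums (deriv f z / f z)"
      by (rule logderiv_prodinf_complex_uniform_limit)
         (use z f_zero a_nz in \<open>auto simp: R_def L'_def intro!: holomorphic_intros\<close>)
    also have "(\<lambda>n. deriv (\<lambda>z. weierstrass_factor 2 (z / a n)) z / weierstrass_factor 2 (z / a n))
                 = (\<lambda>n. zeta_term (a n) z)"
    proof
      fix n
      define w where "w = a n"
      have w: "w \<noteq> 0" "z \<noteq> w" using z a_nz range by (auto simp: w_def L'_def)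
      have factor: "weierstrass_factor 2 = (\<lambda>u. (1 - u) * exp (u + u\<^sup>2 / 2))"
        by (simp add: weierstrass_factor_def fun_eq_iff eval_nat_numeral)
      have "((\<lambda>z. (1 - z / w) * exp (z / w + (z / w)\<^sup>2 / 2)) has_field_derivative
              (zeta_term w z * ((1 - z / w) * exp (z / w + (z / w)\<^sup>2 / 2)))) (at z)"
      proof (rule DERIV_cong)
        define E where "E = exp (z / w + (z / w)\<^sup>2 / 2)"
        show "((\<lambda>z. (1 - z / w) * exp (z / w + (z / w)\<^sup>2 / 2)) has_field_derivative
                (- (1 / w) * E + (1 - z / w) * (E * (1 / w + z / w\<^sup>2)))) (at z)"
          unfolding E_def using w by (auto intro!: derivative_eq_intros simp: power2_eq_square)
        have "zeta_term w z * (1 - z / w) = 1 / (z - w) * (1 - z / w) + (1 / w + z / w\<^sup>2) * (1 - z / w)"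
          by (simp only: zeta_term_def distrib_right add.assoc)
        also have "1 / (z - w) * (1 - z / w) = - (1 / w)" using w by (simp add: field_simps)
        finally have "zeta_term w z * (1 - z / w) * E = (- (1 / w) + (1 / w + z / w\<^sup>2) * (1 - z / w)) * E"
          by (simp only:)
        thus "- (1 / w) * E + (1 - z / w) * (E * (1 / w + z / w\<^sup>2)) = zeta_term w z * ((1 - z / w) * E)"
          by (simp only: ring_distribs mult_ac)
      qed
      hence "deriv (\<lambda>z. weierstrass_factor 2 (z / w)) z = zeta_term w z * weierstrass_factor 2 (z / w)"
        unfolding factor by (rule DERIV_imp_deriv)
      moreover have "weierstrass_factor 2 (z / w) \<noteq> 0" using w by simp
      ultimately show "deriv (\<lambda>z. weierstrass_factor 2 (z / a n)) z / weierstrass_factor 2 (z / a n) = zeta_term (a n) z"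
        unfolding w_def by simp
    qed
    finally have 1: "(\<lambda>n. zeta_term (a n) z) sums (deriv f z / f z)" .
    have "(\<lambda>\<omega>. zeta_term \<omega> z) summable_on L'"
      using locally_dominated_summable[OF zeta_term_locally_dominated[OF \<tau>], of z UNIV]
      by (rule summable_on_subset) (auto simp: L'_def)
    hence "((\<lambda>\<omega>. zeta_term \<omega> z) has_sum (weierstrass_zeta \<tau> z - 1 / z)) L'"
      using has_sum_infsum[of "\<lambda>\<omega>. zeta_term \<omega> z" L'] by (simp add: weierstrass_zeta_def L'_def zeta_term_def[abs_def])
    hence "((\<lambda>n. zeta_term (a n) z) has_sum (weierstrass_zeta \<tau> z - 1 / z)) UNIV"
      using has_sum_reindex_bij_betw[OF a, of "\<lambda>\<omega>. zeta_term \<omega> z"] by simp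
    hence "(\<lambda>n. zeta_term (a n) z) sums (weierstrass_zeta \<tau> z - 1 / z)" by (rule has_sum_imp_sums)
    with 1 show ?thesis by (rule sums_unique2)
  qed
  show ?thesis
  proof (rule that[of \<sigma>])
    show "\<sigma> holomorphic_on UNIV" unfolding \<sigma>_def by (intro holomorphic_intros f_holo)
    show "\<sigma> z = 0 \<longleftrightarrow> z \<in> period_lattice \<tau>" for z by (auto simp: \<sigma>_def f_zero L'_def)
    show "zorder \<sigma> z = 1" if "z \<in> period_lattice \<tau>" for z
    proof (cases "z = 0")
      case True
      have "deriv \<sigma> 0 = f 0"
        unfolding \<sigma>_def by (rule DERIV_imp_deriv)
          (auto intro!: derivative_eq_intros holomorphic_derivI[OF f_holo[of UNIV]])
      hence "zorder \<sigma> 0 = 1"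
        by (intro zorder_zero_eqI'[where n = 1, simplified])
           (auto simp: \<sigma>_def f_zero L'_def intro!: analytic_intros analytic)
      thus ?thesis using True by simp
    next
      case False
      have "zorder f z = card (a -` {z})" by (rule zorder)
      also have "\<exists>n. z = a n" using that False range by (auto simp: L'_def)
      then obtain n where "z = a n" by blast
      hence "a -` {z} = {n}" using inj by (auto dest: injD)
      finally have 1: "zorder f z = 1" by simp
      have "eventually (\<lambda>w. f w \<noteq> 0) (at z)"
        using isolated_zero[of z] that False range unfolding isolated_zero_def by (auto simp: L'_def)
      moreover have "eventually (\<lambda>w. w \<noteq> 0) (at z)"
        using False by (intro tendsto_imp_eventually_ne[of "\<lambda>w. w" z]) auto
      ultimately have "eventually (\<lambda>w. w * f w \<noteq> 0) (at z)"
        by eventually_elim simp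
      hence "zorder \<sigma> z = zorder (\<lambda>z. z) z + zorder f z"
        unfolding \<sigma>_def
        by (intro zorder_times_analytic analytic) (auto intro!: analytic_intros)
      also have "zorder (\<lambda>z. z) z = 0" using False by (intro zorder_eq_0I) auto
      finally show ?thesis using 1 by simp
    qed
    show "deriv \<sigma> z = weierstrass_zeta \<tau> z * \<sigma> z" if "z \<notin> period_lattice \<tau>" for z
    proof -
      have "z \<noteq> 0" "f z \<noteq> 0" using that by (auto simp: f_zero L'_def)
      have "deriv \<sigma> z = f z + z * deriv f z"
        unfolding \<sigma>_def by (rule DERIV_imp_deriv)
          (auto intro!: derivative_eq_intros holomorphic_derivI[OF f_holo[of UNIV]])
      moreover have "deriv f z = (weierstrass_zeta \<tau> z - 1 / z) * f z"
        using logderiv[OF that] \<open>f z \<noteq> 0\<close> by (simp add: field_simps)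
      ultimately show ?thesis using \<open>z \<noteq> 0\<close> by (simp add: \<sigma>_def algebra_simps)
    qed
  qed
qed

text \<open>By the additive law for the zeta function the quotient \<open>g\<close> has derivative 0
  off the lattice. Removing a countable set leaves the plane connected, so \<open>g\<close> is a
  single constant. The classical value of \<open>C\<close> is not computed, as it will enter with
  total exponent \<open>\<Sum>m\<^sub>\<alpha> = 0\<close>.\<close>

lemma sigma_quasiperiodic:
  assumes \<tau>: "Im \<tau> > 0" and holo: "\<sigma> holomorphic_on UNIV"
    and zero: "\<And>z. \<sigma> z = 0 \<longleftrightarrow> z \<in> period_lattice \<tau>"
    and deriv: "\<And>z. z \<notin> period_lattice \<tau> \<Longrightarrow> deriv \<sigma> z = weierstrass_zeta \<tau> z * \<sigma> z"
    and \<omega>: "\<omega> \<in> period_lattice \<tau>"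
  obtains C \<eta> where "C \<noteq> 0" "\<And>z. \<sigma> (z + \<omega>) = C * exp (\<eta> * z) * \<sigma> z"
proof -
  let ?A = "- period_lattice \<tau>"
  obtain \<eta> where \<eta>: "\<And>z. weierstrass_zeta \<tau> (z + \<omega>) = weierstrass_zeta \<tau> z + \<eta>"
    using weierstrass_zeta_quasiperiodic[OF \<tau> \<omega>] by metis
  have open_A: "open ?A" using closed_period_lattice[OF \<tau>] by auto
  have "connected (UNIV - period_lattice \<tau> :: complex set)"
    by (rule connected_open_diff_countable) (auto intro: countable_period_lattice)
  hence conn: "connected ?A" by (simp add: Compl_eq_Diff_UNIV)
  define g where "g = (\<lambda>z. \<sigma> (z + \<omega>) * exp (- \<eta> * z) / \<sigma> z)"
  have der: "(\<sigma> has_field_derivative (weierstrass_zeta \<tau> z * \<sigma> z)) (at z)" if "z \<in> ?A" for z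
    using holomorphic_derivI[OF holo, of z UNIV] deriv[of z] that by auto
  have "(g has_field_derivative 0) (at z)" if z: "z \<in> ?A" for z
  proof -
    have nz: "\<sigma> z \<noteq> 0" using z zero by auto
    have "z + \<omega> \<in> ?A" using z \<omega> by simp
    from der[OF this] have d: "((\<lambda>z. \<sigma> (z + \<omega>)) has_field_derivative ((weierstrass_zeta \<tau> z + \<eta>) * \<sigma> (z + \<omega>))) (at z)"
      unfolding \<eta> by (subst (asm) DERIV_shift) auto
    have e: "((\<lambda>z. exp (- \<eta> * z)) has_field_derivative (- \<eta> * exp (- \<eta> * z))) (at z)"
      by (auto intro!: derivative_eq_intros)
    show ?thesis
      unfolding g_def by (rule DERIV_cong[OF DERIV_divide[OF DERIV_mult[OF d e] der[OF z] nz]]) (simp add: algebra_simps)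
  qed
  hence "\<exists>C. \<forall>z\<in>?A. g z = C"
    using has_field_derivative_0_imp_constant_on[of ?A g] conn open_A by (auto simp: constant_on_def)
  then obtain C where C: "\<And>z. z \<in> ?A \<Longrightarrow> g z = C" by blast
  have eq: "\<sigma> (z + \<omega>) = C * exp (\<eta> * z) * \<sigma> z" for z
  proof (cases "z \<in> ?A")
    case True
    hence "\<sigma> z \<noteq> 0" by (simp add: zero)
    thus ?thesis using C[OF True] by (auto simp: g_def exp_minus field_simps)
  next
    case False
    thus ?thesis using \<omega> zero[of z] zero[of "z + \<omega>"] by simp
  qed
  have "?A \<noteq> {}"
    using countable_period_lattice[of \<tau>] uncountable_UNIV_complex by (metis Compl_empty_eq double_complement)
  then obtain z where "z \<in> ?A" by blast
  hence "\<sigma> (z + \<omega>) \<noteq> 0" using \<omega> zero by simp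
  hence "C \<noteq> 0" using eq[of z] by auto
  thus ?thesis using eq that by blast
qed

section \<open>The elliptic function of a principal divisor\<close>

lemma eventually_at_notin_shifted_lattice:
  assumes "Im \<tau> > 0"
  shows "eventually (\<lambda>w. w - \<alpha> \<notin> period_lattice \<tau>) (at x)"
proof -
  define S where "S = {w. w - \<alpha> \<in> period_lattice \<tau>}"
  have "\<not> x islimpt S"
  proof
    assume "x islimpt S"
    hence "infinite (S \<inter> ball x 1)" by (simp add: islimpt_eq_infinite_ball)
    moreover have "S \<inter> ball x 1 \<subseteq> (\<lambda>\<omega>. \<omega> + \<alpha>) ` {\<omega> \<in> period_lattice \<tau>. cmod ((\<alpha> - x) + \<omega>) \<le> 1}"
    proof
      fix w assume w: "w \<in> S \<inter> ball x 1"
      hence "w - \<alpha> \<in> period_lattice \<tau>" "cmod ((\<alpha> - x) + (w - \<alpha>)) \<le> 1" "w = (w - \<alpha>) + \<alpha>"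
        by (auto simp: S_def dist_norm norm_minus_commute)
      thus "w \<in> (\<lambda>\<omega>. \<omega> + \<alpha>) ` {\<omega> \<in> period_lattice \<tau>. cmod ((\<alpha> - x) + \<omega>) \<le> 1}" by blast
    qed
    ultimately show False
      using finite_period_lattice_ball_shifted[OF assms, of "\<alpha> - x" 1] finite_subset by blast
  qed
  thus ?thesis by (simp add: islimpt_iff_eventually S_def)
qed

lemma to_torus_eq_iff: "to_torus \<tau> x = to_torus \<tau> y \<longleftrightarrow> x - y \<in> period_lattice \<tau>"
proof
  assume "to_torus \<tau> x = to_torus \<tau> y"
  moreover have "y \<in> to_torus \<tau> y" by (simp add: to_torus_def lattice_rel_def)
  ultimately show "x - y \<in> period_lattice \<tau>" by (auto simp: to_torus_def lattice_rel_def)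
next
  assume *: "x - y \<in> period_lattice \<tau>"
  have "x - z \<in> period_lattice \<tau> \<longleftrightarrow> y - z \<in> period_lattice \<tau>" for z
    using period_lattice_add_iff(1)[OF *, of "y - z"] by (simp add: algebra_simps)
  thus "to_torus \<tau> x = to_torus \<tau> y" by (auto simp: to_torus_def lattice_rel_def)
qed

lemma has_field_derivative_prod_powi:
  fixes g :: "'i \<Rightarrow> complex \<Rightarrow> complex" and c :: "'i \<Rightarrow> int"
  assumes "finite I" "\<And>i. i \<in> I \<Longrightarrow> (g i has_field_derivative g' i) (at z)" "\<And>i. i \<in> I \<Longrightarrow> g i z \<noteq> 0"
  shows "((\<lambda>z. \<Prod>i\<in>I. g i z powi c i) has_field_derivative
           (\<Prod>i\<in>I. g i z powi c i) * (\<Sum>i\<in>I. of_int (c i) * (g' i / g i z))) (at z)"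
  using assms
proof (induction I rule: finite_induct)
  case (insert i I)
  have "((\<lambda>z. g i z powi c i) has_field_derivative (of_int (c i) * g i z powi (c i - 1) * g' i)) (at z)"
    by (rule DERIV_power_int) (use insert in auto)
  also have "of_int (c i) * g i z powi (c i - 1) * g' i = g i z powi c i * (of_int (c i) * (g' i / g i z))"
    using insert.prems(2)[of i] by (simp add: power_int_diff)
  finally have 1: "((\<lambda>z. g i z powi c i) has_field_derivative g i z powi c i * (of_int (c i) * (g' i / g i z))) (at z)" .
  have 2: "((\<lambda>z. \<Prod>i\<in>I. g i z powi c i) has_field_derivative
           (\<Prod>i\<in>I. g i z powi c i) * (\<Sum>i\<in>I. of_int (c i) * (g' i / g i z))) (at z)"
    using insert by auto
  from DERIV_mult[OF 1 2] insert.hyps show ?case by (simp add: algebra_simps)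
qed simp

text \<open>Translating the sigma product by a period multiplies it by the exponential of \<open>(k
  + \<eta> z) \<Sum>m\<^sub>\<alpha> - \<eta> \<Sum>m\<^sub>\<alpha> \<alpha>\<close>. The second
  sum has to vanish in the plane and not just modulo the lattice, which is what a principal lift
  provides.\<close>

lemma normalized_elliptic_fun_exists:
  assumes \<tau>: "Im \<tau> > 0" and D: "is_divisor \<tau> D" and lift: "is_lift \<tau> D m"
    and deg: "lift_degree m = 0" and sum0: "lift_sum m = 0"
  obtains f where "elliptic_fun \<tau> f" "has_divisor \<tau> f D"
    "(\<lambda>z. f z / z powi mult_at_origin \<tau> D - 1) \<in> O[at 0](\<lambda>z. z)"
    "\<And>z. (\<And>\<alpha>. \<alpha> \<in> Poly_Mapping.keys m \<Longrightarrow> z - \<alpha> \<notin> period_lattice \<tau>) \<Longrightarrow>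
       deriv f z / f z = (\<Sum>\<alpha>\<in>Poly_Mapping.keys m. of_int (Poly_Mapping.lookup m \<alpha>) * weierstrass_zeta \<tau> (z - \<alpha>))"
proof -
  define K where "K = Poly_Mapping.keys m"
  define c where "c = Poly_Mapping.lookup m"
  have fin: "finite K" by (simp add: K_def)
  have c0: "(\<Sum>\<alpha>\<in>K. c \<alpha>) = 0" using deg by (simp add: lift_degree_def K_def c_def)
  have c1: "(\<Sum>\<alpha>\<in>K. of_int (c \<alpha>) * \<alpha>) = 0" using sum0 by (simp add: lift_sum_def K_def c_def)
  obtain \<sigma> where \<sigma>: "\<sigma> holomorphic_on UNIV" "\<And>z. \<sigma> z = 0 \<longleftrightarrow> z \<in> period_lattice \<tau>"
    "\<And>z. z \<in> period_lattice \<tau> \<Longrightarrow> zorder \<sigma> z = 1"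
    "\<And>z. z \<notin> period_lattice \<tau> \<Longrightarrow> deriv \<sigma> z = weierstrass_zeta \<tau> z * \<sigma> z"
    using weierstrass_sigma_exists[OF \<tau>] by metis
  define f0 where "f0 = (\<lambda>z. \<Prod>\<alpha>\<in>K. \<sigma> (z - \<alpha>) powi c \<alpha>)"
  have \<sigma>_ana: "(\<lambda>z. \<sigma> (z - \<alpha>)) analytic_on A" for \<alpha> A
  proof -
    have "(\<lambda>z. \<sigma> (z - \<alpha>)) holomorphic_on UNIV"
      by (rule holomorphic_on_compose_gen[of "\<lambda>z. z - \<alpha>" UNIV \<sigma> UNIV, unfolded o_def])
         (use \<sigma>(1) in \<open>auto intro!: holomorphic_intros\<close>)
    thus ?thesis using analytic_on_open[OF open_UNIV] analytic_on_subset by blast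
  qed
  have mero0: "f0 meromorphic_on A" for A
    unfolding f0_def by (intro meromorphic_intros analytic_on_imp_meromorphic_on \<sigma>_ana)
  have ev_good: "eventually (\<lambda>w. \<forall>\<alpha>\<in>K. w - \<alpha> \<notin> period_lattice \<tau>) (at z)" for z
    using fin eventually_at_notin_shifted_lattice[OF \<tau>] by (simp add: eventually_ball_finite)
  have f0_nz: "f0 z \<noteq> 0" if "\<forall>\<alpha>\<in>K. z - \<alpha> \<notin> period_lattice \<tau>" for z
    unfolding f0_def using that fin \<sigma>(2) by simp
  have ev_nz: "eventually (\<lambda>w. f0 w \<noteq> 0) (at z)" for z
    using ev_good[of z] by eventually_elim (rule f0_nz)
  have zorder0: "zorder f0 z = Poly_Mapping.lookup D (to_torus \<tau> z)" for z
  proof -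
    have "zorder f0 z = (\<Sum>\<alpha>\<in>K. zorder (\<lambda>z. \<sigma> (z - \<alpha>) powi c \<alpha>) z)"
      unfolding f0_def
    proof (rule zorder_prod)
      show "(\<lambda>z. \<sigma> (z - \<alpha>) powi c \<alpha>) meromorphic_on {z}" for \<alpha>
        by (rule meromorphic_on_powi[OF analytic_on_imp_meromorphic_on[OF \<sigma>_ana]])
    qed (use ev_nz[of z] in \<open>simp add: f0_def\<close>)
    also have "\<dots> = (\<Sum>\<alpha>\<in>K. if to_torus \<tau> \<alpha> = to_torus \<tau> z then c \<alpha> else 0)"
    proof (rule sum.cong)
      fix \<alpha> assume "\<alpha> \<in> K"
      have "eventually (\<lambda>w. \<sigma> (w - \<alpha>) \<noteq> 0) (at z)"
        using eventually_at_notin_shifted_lattice[OF \<tau>, of \<alpha> z] by eventually_elim (simp add: \<sigma>(2))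
      hence "zorder (\<lambda>z. \<sigma> (z - \<alpha>) powi c \<alpha>) z = c \<alpha> * zorder (\<lambda>z. \<sigma> (z - \<alpha>)) z"
        by (intro zorder_power_int analytic_on_imp_meromorphic_on \<sigma>_ana eventually_frequently) auto
      also have "zorder (\<lambda>z. \<sigma> (z - \<alpha>)) z = zorder \<sigma> (z - \<alpha>)"
        using zorder_shift[of "\<lambda>z. \<sigma> (z - \<alpha>)" z] zorder_shift[of \<sigma> "z - \<alpha>"] by (simp add: algebra_simps)
      also have "\<dots> = (if to_torus \<tau> \<alpha> = to_torus \<tau> z then 1 else 0)"
      proof (cases "z - \<alpha> \<in> period_lattice \<tau>")
        case True
        thus ?thesis using \<sigma>(3) by (simp add: to_torus_eq_iff period_lattice_minus_commute[of \<alpha>])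
      next
        case False
        have "zorder \<sigma> (z - \<alpha>) = 0"
          by (rule zorder_eq_0I) (use \<sigma>_ana[of 0] \<sigma>(2) False in auto)
        thus ?thesis using False by (simp add: to_torus_eq_iff period_lattice_minus_commute[of \<alpha>])
      qed
      finally show "zorder (\<lambda>z. \<sigma> (z - \<alpha>) powi c \<alpha>) z = (if to_torus \<tau> \<alpha> = to_torus \<tau> z then c \<alpha> else 0)"
        by simp
    qed auto
    \<comment> \<open>Several \<alpha> may lie over the same point of the torus; their orders add up
      to the coefficient of the pushforward.\<close>
    also have "\<dots> = Poly_Mapping.lookup D (to_torus \<tau> z)"
      using lift fin unfolding is_lift_def K_def c_def by (simp add: sum.If_cases Int_def)
    finally show ?thesis .
  qed
  have periodic0: "f0 (z + \<omega>) = f0 z" if \<omega>: "\<omega> \<in> period_lattice \<tau>" for z \<omega>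
  proof -
    obtain C \<eta> where C: "C \<noteq> 0" "\<And>z. \<sigma> (z + \<omega>) = C * exp (\<eta> * z) * \<sigma> z"
      using sigma_quasiperiodic[OF \<tau> \<sigma>(1,2,4) \<omega>] by metis
    \<comment> \<open>With \<open>C = exp k\<close> the integer powers become exponentials, whose
      exponents can be added over \<open>K\<close>.\<close>
    define k where "k = Ln C"
    have C': "\<sigma> (z + \<omega> - \<alpha>) = exp (k + \<eta> * (z - \<alpha>)) * \<sigma> (z - \<alpha>)" for \<alpha>
    proof -
      have "z + \<omega> - \<alpha> = (z - \<alpha>) + \<omega>" by simp
      moreover have "C * exp (\<eta> * (z - \<alpha>)) = exp (k + \<eta> * (z - \<alpha>))"
        using C(1) by (simp add: k_def exp_add)
      ultimately show ?thesis using C(2)[of "z - \<alpha>"] by (simp only:)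
    qed
    have "f0 (z + \<omega>) = (\<Prod>\<alpha>\<in>K. exp (of_int (c \<alpha>) * (k + \<eta> * (z - \<alpha>)))) * f0 z"
      unfolding f0_def C' power_int_mult_distrib exp_power_int prod.distrib ..
    also have "(\<Prod>\<alpha>\<in>K. exp (of_int (c \<alpha>) * (k + \<eta> * (z - \<alpha>)))) =
                 exp (\<Sum>\<alpha>\<in>K. of_int (c \<alpha>) * (k + \<eta> * (z - \<alpha>)))"
      using fin by (simp add: exp_sum)
    also have "(\<Sum>\<alpha>\<in>K. of_int (c \<alpha>) * (k + \<eta> * (z - \<alpha>))) =
                 (k + \<eta> * z) * of_int (\<Sum>\<alpha>\<in>K. c \<alpha>) - \<eta> * (\<Sum>\<alpha>\<in>K. of_int (c \<alpha>) * \<alpha>)"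
      by (simp add: sum_distrib_left sum.distrib sum_subtractf algebra_simps)
    also have "\<dots> = 0" by (simp add: c0 c1)
    finally show ?thesis by simp
  qed
  \<comment> \<open>At zeros of the sigma factors \<open>f0\<close> takes conventional values such
    as \<open>0 powi n\<close>. \<open>remove_sings\<close> replaces them by limits, or by 0 at
    poles, and keeps the orders.\<close>
  define f1 where "f1 = remove_sings f0"
  have iso0: "isolated_singularity_at f0 z" for z
    using mero0[of "{z}"] by (simp add: meromorphic_at_iff)
  have mero1: "f1 nicely_meromorphic_on UNIV"
    unfolding f1_def by (rule remove_sings_nicely_meromorphic[OF mero0])
  have periodic1: "f1 (z + \<omega>) = f1 z" if "\<omega> \<in> period_lattice \<tau>" for z \<omega>
  proof -
    \<comment> \<open>Shifting the base point to 0 turns both values into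
      \<open>remove_sings\<close> of the same function.\<close>
    have "f1 (z + \<omega>) = remove_sings (\<lambda>w. f0 ((z + w) + \<omega>)) 0"
      unfolding f1_def by (subst remove_sings_shift_0) (simp add: add_ac)
    also have "\<dots> = f1 z"
      unfolding f1_def by (subst (2) remove_sings_shift_0) (simp add: periodic0[OF that])
    finally show ?thesis .
  qed
  have zorder1: "zorder f1 z = Poly_Mapping.lookup D (to_torus \<tau> z)" for z
    unfolding f1_def using zorder0 iso0 by simp
  have f1_good: "f1 z \<noteq> 0 \<and> (f1 has_field_derivative
      f1 z * (\<Sum>\<alpha>\<in>K. of_int (c \<alpha>) * weierstrass_zeta \<tau> (z - \<alpha>))) (at z)"
    if z: "\<forall>\<alpha>\<in>K. z - \<alpha> \<notin> period_lattice \<tau>" for z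
  proof -
    have ana: "f0 analytic_on {z}"
      unfolding f0_def by (intro analytic_intros \<sigma>_ana) (use z \<sigma>(2) in auto)
    have "(f0 has_field_derivative (\<Prod>\<alpha>\<in>K. \<sigma> (z - \<alpha>) powi c \<alpha>) *
            (\<Sum>\<alpha>\<in>K. of_int (c \<alpha>) * (deriv \<sigma> (z - \<alpha>) / \<sigma> (z - \<alpha>)))) (at z)"
      unfolding f0_def
    proof (rule has_field_derivative_prod_powi[OF fin])
      fix \<alpha> assume "\<alpha> \<in> K"
      show "((\<lambda>z. \<sigma> (z - \<alpha>)) has_field_derivative deriv \<sigma> (z - \<alpha>)) (at z)"
        using holomorphic_derivI[OF \<sigma>(1), of "z - \<alpha>" UNIV] DERIV_shift[of \<sigma> _ z "- \<alpha>"] by simp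
      show "\<sigma> (z - \<alpha>) \<noteq> 0" using z \<sigma>(2) \<open>\<alpha> \<in> K\<close> by auto
    qed
    also have "(\<Sum>\<alpha>\<in>K. of_int (c \<alpha>) * (deriv \<sigma> (z - \<alpha>) / \<sigma> (z - \<alpha>))) =
        (\<Sum>\<alpha>\<in>K. of_int (c \<alpha>) * weierstrass_zeta \<tau> (z - \<alpha>))"
      using z \<sigma>(2,4) by (intro sum.cong) auto
    finally have der: "(f0 has_field_derivative f0 z * (\<Sum>\<alpha>\<in>K. of_int (c \<alpha>) * weierstrass_zeta \<tau> (z - \<alpha>))) (at z)"
      by (simp add: f0_def)
    have eq: "f1 z = f0 z" unfolding f1_def using ana by simp
    have "eventually (\<lambda>w. f0 w = f1 w) (nhds z)"
      using eventually_remove_sings_eq_nhds[OF ana] by eventually_elim (simp add: f1_def)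
    with DERIV_cong_ev[OF refl this refl] der eq f0_nz[OF z] show ?thesis by simp
  qed
  have ev1_nz: "eventually (\<lambda>w. f1 w \<noteq> 0) (at z)" for z
    using ev_good[of z] by eventually_elim (use f1_good in blast)
  define n where "n = mult_at_origin \<tau> D"
  have n: "n = zorder f1 0" by (simp add: n_def mult_at_origin_def zorder1)
  \<comment> \<open>Near 0 one has \<open>f1 w = g w * w powi n\<close> with
    \<open>g 0 \<noteq> 0\<close>. Dividing by \<open>g 0\<close> normalizes the leading
    coefficient, and differentiability of \<open>g\<close> at 0 is the required
    \<open>O(z)\<close>.\<close>
  define g where "g = zor_poly f1 0"
  have "f1 meromorphic_on {0}"
    using mero1 unfolding nicely_meromorphic_on_def by (auto intro: meromorphic_on_subset)
  then obtain r where g: "g 0 \<noteq> 0" "r > 0" "g holomorphic_on cball 0 r"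
    "\<And>w. w \<in> cball 0 r - {0} \<Longrightarrow> f1 w = g w * w powi n"
    using zorder_exist[of f1 0] ev1_nz[of 0] unfolding n g_def
    by (auto simp: meromorphic_at_iff eventually_frequently)
  define f where "f = (\<lambda>z. (1 / g 0) * f1 z)"
  show ?thesis
  proof (rule that[of f])
    show "elliptic_fun \<tau> f"
      unfolding elliptic_fun_def f_def
      by (intro conjI nicely_meromorphic_on_cmult_left mero1) (simp add: periodic1)
    obtain z where "f1 z \<noteq> 0" using eventually_happens[OF ev1_nz[of 0]] by auto
    moreover have "zorder f z = zorder f1 z" for z
      unfolding f_def by (rule zorder_cmult) (use g(1) in simp)
    ultimately show "has_divisor \<tau> f D"
      unfolding has_divisor_def using D g(1) zorder1 by (auto simp: f_def)
    have "(g has_field_derivative deriv g 0) (at 0)"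
      using holomorphic_derivI[of g "ball 0 r" 0] g(2,3) ball_subset_cball holomorphic_on_subset by fastforce
    hence "((\<lambda>w. (g w - g 0) / (w - 0)) \<longlongrightarrow> deriv g 0) (at 0)"
      by (simp add: has_field_derivative_iff)
    hence "(\<lambda>w. (g w - g 0)) \<in> O[at 0](\<lambda>w. w)"
      by (intro bigoI_tendsto[where c = "deriv g 0"]) (auto simp: eventually_at_filter)
    hence big: "(\<lambda>w. (1 / g 0) * (g w - g 0)) \<in> O[at 0](\<lambda>w. w)"
      by (subst landau_o.big.cmult_in_iff) (use g(1) in auto)
    have "eventually (\<lambda>w. (1 / g 0) * (g w - g 0) = f w / w powi n - 1) (at 0)"
    proof -
      have "eventually (\<lambda>w. w \<in> cball 0 r - {0}) (at (0::complex))"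
        using g(2) unfolding eventually_at by (intro exI[of _ r]) auto
      thus ?thesis
        by eventually_elim (use g(1,4) in \<open>auto simp: f_def field_simps\<close>)
    qed
    from landau_o.big.in_cong[OF this] big
    show "(\<lambda>z. f z / z powi mult_at_origin \<tau> D - 1) \<in> O[at 0](\<lambda>z. z)"
      unfolding n_def[symmetric] by blast
    fix z assume "\<And>\<alpha>. \<alpha> \<in> Poly_Mapping.keys m \<Longrightarrow> z - \<alpha> \<notin> period_lattice \<tau>"
    hence z: "\<forall>\<alpha>\<in>K. z - \<alpha> \<notin> period_lattice \<tau>" by (simp add: K_def)
    have "(f has_field_derivative (1 / g 0) * (f1 z * (\<Sum>\<alpha>\<in>K. of_int (c \<alpha>) * weierstrass_zeta \<tau> (z - \<alpha>)))) (at z)"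
      unfolding f_def by (rule DERIV_cmult) (use f1_good[OF z] in blast)
    hence "deriv f z = (1 / g 0) * (f1 z * (\<Sum>\<alpha>\<in>K. of_int (c \<alpha>) * weierstrass_zeta \<tau> (z - \<alpha>)))"
      by (rule DERIV_imp_deriv)
    thus "deriv f z / f z = (\<Sum>\<alpha>\<in>Poly_Mapping.keys m. of_int (Poly_Mapping.lookup m \<alpha>) * weierstrass_zeta \<tau> (z - \<alpha>))"
      using f1_good[OF z] g(1) by (simp add: f_def K_def c_def)
  qed
qed

section \<open>Uniqueness of the normalized elliptic function\<close>

text \<open>Passing to the fractional parts of the real coordinates shows that all values are
  already taken on a compact parallelogram, so the function is bounded.\<close>

lemma periodic_entire_constant:
  assumes \<tau>: "Im \<tau> > 0" and holo: "q holomorphic_on UNIV"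
    and per: "\<And>z \<omega>. \<omega> \<in> period_lattice \<tau> \<Longrightarrow> q (z + \<omega>) = q z"
  shows "\<exists>k. \<forall>z. q z = k"
proof -
  define S where "S = (\<lambda>(x, y). complex_of_real x + of_real y * \<tau>) ` ({0..1} \<times> {0..1})"
  have "compact S"
    unfolding S_def case_prod_unfold by (intro compact_continuous_image compact_Times continuous_intros) auto
  have "range q \<subseteq> q ` S"
  proof
    fix v assume "v \<in> range q"
    then obtain z where v: "v = q z" by blast
    define y x where "y = Im z / Im \<tau>" and "x = Re z - y * Re \<tau>"
    have z: "z = of_real x + of_real y * \<tau>"
      using \<tau> by (simp add: complex_eq_iff x_def y_def)
    define z' where "z' = complex_of_real (frac x) + of_real (frac y) * \<tau>"
    have "z = z' + (of_int \<lfloor>x\<rfloor> + of_int \<lfloor>y\<rfloor> * \<tau>)"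
      unfolding z z'_def by (simp add: frac_def algebra_simps)
    hence "v = q z'" unfolding v using per[OF period_latticeI] by simp
    moreover have "z' \<in> S"
      unfolding S_def z'_def by (rule image_eqI[of _ _ "(frac x, frac y)"]) (auto simp: frac_lt_1 less_imp_le)
    ultimately show "v \<in> q ` S" by blast
  qed
  moreover have "bounded (q ` S)"
    using \<open>compact S\<close> holo
    by (intro compact_imp_bounded compact_continuous_image)
       (auto intro: holomorphic_on_imp_continuous_on holomorphic_on_subset)
  ultimately have "bounded (range q)" using bounded_subset by blast
  with holo have "q constant_on UNIV" by (rule Liouville_theorem)
  thus ?thesis by (auto simp: constant_on_def)
qed

lemma elliptic_fun_eventually_nonzero:
  assumes "elliptic_fun \<tau> f" "has_divisor \<tau> f D"
  shows "eventually (\<lambda>w. f w \<noteq> 0) (at z)"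
proof -
  have "(\<forall>x\<in>UNIV. f x = 0) \<or> eventually (\<lambda>x. f x \<noteq> 0) (cosparse UNIV)"
    by (rule nicely_meromorphic_imp_constant_or_avoid) (use assms in \<open>auto simp: elliptic_fun_def\<close>)
  with assms(2) have "eventually (\<lambda>x. f x \<noteq> 0) (cosparse UNIV)" by (auto simp: has_divisor_def)
  thus ?thesis by (rule eventually_cosparse_imp_eventually_at) auto
qed

lemma tendsto_normalized:
  fixes f :: "complex \<Rightarrow> complex"
  assumes "(\<lambda>z. f z / z powi n - 1) \<in> O[at 0](\<lambda>z. z)"
  shows "((\<lambda>z. f z / z powi n) \<longlongrightarrow> 1) (at 0)"
proof -
  obtain c where c: "eventually (\<lambda>z. norm (f z / z powi n - 1) \<le> c * norm z) (at 0)"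
    using assms by (elim landau_o.bigE)
  have "((\<lambda>z::complex. c * norm z) \<longlongrightarrow> c * norm (0::complex)) (at 0)"
    by (intro tendsto_intros)
  hence "((\<lambda>z. f z / z powi n - 1) \<longlongrightarrow> 0) (at 0)"
    by (intro Lim_null_comparison[OF c]) simp
  thus ?thesis by (simp add: LIM_zero_iff)
qed

lemma normalized_elliptic_fun_unique:
  assumes \<tau>: "Im \<tau> > 0"
    and f: "elliptic_fun \<tau> f" "has_divisor \<tau> f D" "(\<lambda>z. f z / z powi n - 1) \<in> O[at 0](\<lambda>z. z)"
    and g: "elliptic_fun \<tau> g" "has_divisor \<tau> g D" "(\<lambda>z. g z / z powi n - 1) \<in> O[at 0](\<lambda>z. z)"
  shows "f = g"
proof -
  define h where "h = (\<lambda>z. f z / g z)"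
  define q where "q = remove_sings h"
  have mero: "f meromorphic_on A" "g meromorphic_on A" for A
    using f(1) g(1) unfolding elliptic_fun_def nicely_meromorphic_on_def
    by (auto intro: meromorphic_on_subset)
  have f_nz: "eventually (\<lambda>w. f w \<noteq> 0) (at z)" and g_nz: "eventually (\<lambda>w. g w \<noteq> 0) (at z)" for z
    using elliptic_fun_eventually_nonzero f(1,2) g(1,2) by blast+
  have mero_h: "h meromorphic_on A" for A unfolding h_def by (intro meromorphic_intros mero)
  have q_ana: "q analytic_on {z}" for z
  proof -
    have "eventually (\<lambda>w. h w \<noteq> 0) (at z)"
      using f_nz[of z] g_nz[of z] by eventually_elim (simp add: h_def)
    hence freq: "frequently (\<lambda>w. h w \<noteq> 0) (at z)" by (intro eventually_frequently) auto
    have "zorder h z = zorder f z - zorder g z"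
      unfolding h_def
      by (rule Meromorphic.zorder_divide) (use f_nz g_nz in \<open>auto intro!: eventually_frequently mero\<close>)
    hence zorder: "zorder h z = 0" using f(2) g(2) by (simp add: has_divisor_def)
    have iso: "isolated_singularity_at h z" and ness: "not_essential h z"
      using mero_h[of "{z}"] by (auto simp: meromorphic_at_iff)
    \<comment> \<open>For order 0 the power of \<open>w - z\<close> is 1, so
      \<open>zor_poly h z\<close> is a holomorphic extension of the quotient across
      \<open>z\<close>.\<close>
    obtain r where r: "r > 0" "zor_poly h z holomorphic_on cball z r"
      "\<And>w. w \<in> cball z r - {z} \<Longrightarrow> h w = zor_poly h z w"
      using zorder_exist[OF iso ness freq] zorder by auto
    have "isCont (zor_poly h z) z"
      using r(1,2) by (intro analytic_at_imp_isCont) (meson analytic_at_ball ball_subset_cball holomorphic_on_subset)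
    hence "zor_poly h z \<midarrow>z\<rightarrow> zor_poly h z z" by (simp add: isCont_def)
    moreover have "eventually (\<lambda>w. zor_poly h z w = h w) (at z)"
      using r(1,3) unfolding eventually_at by (intro exI[of _ r]) (auto simp: dist_commute)
    ultimately have "h \<midarrow>z\<rightarrow> zor_poly h z z" by (rule Lim_transform_eventually)
    thus ?thesis unfolding q_def by (intro remove_sings_analytic_at iso)
  qed
  have "q analytic_on UNIV" using q_ana analytic_on_analytic_at by blast
  hence q_holo: "q holomorphic_on UNIV" by (rule analytic_imp_holomorphic)
  have per: "q (z + \<omega>) = q z" if "\<omega> \<in> period_lattice \<tau>" for z \<omega>
  proof -
    have h_per: "h (w + \<omega>) = h w" for w
      using f(1) g(1) that by (simp add: h_def elliptic_fun_def)
    have "q (z + \<omega>) = remove_sings (\<lambda>w. h ((z + w) + \<omega>)) 0"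
      unfolding q_def by (subst remove_sings_shift_0) (simp add: add_ac)
    also have "\<dots> = q z"
      unfolding q_def by (subst (2) remove_sings_shift_0) (simp add: h_per)
    finally show ?thesis .
  qed
  obtain k where k: "\<And>z. q z = k" using periodic_entire_constant[OF \<tau> q_holo per] by blast
  have h_eq: "eventually (\<lambda>w. h w = k) (at z)" for z
  proof -
    have "eventually (\<lambda>w. remove_sings h w = h w) (at z)"
      using mero_h[of "{z}"] by (intro eventually_remove_sings_eq_at) (simp add: meromorphic_at_iff)
    thus ?thesis by eventually_elim (use k in \<open>simp add: q_def\<close>)
  qed
  have "((\<lambda>z. (f z / z powi n) / (g z / z powi n)) \<longlongrightarrow> 1 / 1) (at 0)"
    by (intro tendsto_divide tendsto_normalized f g) auto
  moreover have "eventually (\<lambda>z. (f z / z powi n) / (g z / z powi n) = k) (at 0)"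
  proof -
    have "eventually (\<lambda>z::complex. z \<noteq> 0) (at 0)" by (simp add: eventually_at_filter)
    with h_eq[of 0] show ?thesis by eventually_elim (simp add: h_def)
  qed
  ultimately have "((\<lambda>z::complex. k) \<longlongrightarrow> 1) (at 0)"
    by (auto elim: Lim_transform_eventually)
  hence k1: "k = 1" by (simp add: tendsto_const_iff)
  \<comment> \<open>So far the functions agree only near each point, not at it. A nicely meromorphic
    function is recovered from nearby values, as its limit or as 0 at a pole, hence
    \<open>remove_sings\<close> fixes both functions.\<close>
  have "f z = g z" for z
  proof -
    have "eventually (\<lambda>w. f w = g w) (at z)"
      using h_eq[of z] g_nz[of z] by eventually_elim (simp add: h_def k1)
    hence "remove_sings f z = remove_sings g z" by (rule remove_sings_cong) simp
    moreover have "remove_sings u z = u z" if "elliptic_fun \<tau> u" for u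
    proof -
      have "is_pole u z \<and> u z = 0 \<or> u \<midarrow>z\<rightarrow> u z"
        using that unfolding elliptic_fun_def nicely_meromorphic_on_def by blast
      thus ?thesis by auto
    qed
    ultimately show ?thesis using f(1) g(1) by simp
  qed
  thus ?thesis by (rule ext)
qed

lemma elliptic_fun_of_divisor_logderiv:
  assumes "Im \<tau> > 0" "is_divisor \<tau> D" "is_lift \<tau> D m" "lift_degree m = 0" "lift_sum m = 0"
    and "\<And>\<alpha>. \<alpha> \<in> Poly_Mapping.keys m \<Longrightarrow> z - \<alpha> \<notin> period_lattice \<tau>"
  shows "deriv (elliptic_fun_of_divisor \<tau> D) z / elliptic_fun_of_divisor \<tau> D z =
    (\<Sum>\<alpha>\<in>Poly_Mapping.keys m. of_int (Poly_Mapping.lookup m \<alpha>) * weierstrass_zeta \<tau> (z - \<alpha>))"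
proof -
  obtain f where f: "elliptic_fun \<tau> f" "has_divisor \<tau> f D"
    "(\<lambda>z. f z / z powi mult_at_origin \<tau> D - 1) \<in> O[at 0](\<lambda>z. z)"
    "\<And>z. (\<And>\<alpha>. \<alpha> \<in> Poly_Mapping.keys m \<Longrightarrow> z - \<alpha> \<notin> period_lattice \<tau>) \<Longrightarrow>
       deriv f z / f z = (\<Sum>\<alpha>\<in>Poly_Mapping.keys m. of_int (Poly_Mapping.lookup m \<alpha>) * weierstrass_zeta \<tau> (z - \<alpha>))"
    using normalized_elliptic_fun_exists[OF assms(1-5)] by blast
  have "elliptic_fun_of_divisor \<tau> D = f"
    unfolding elliptic_fun_of_divisor_def
  proof (rule the_equality)
    fix g assume "elliptic_fun \<tau> g \<and> has_divisor \<tau> g D \<and>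
      (\<lambda>z. g z / z powi mult_at_origin \<tau> D - 1) \<in> O[at 0](\<lambda>z. z)"
    thus "g = f" using normalized_elliptic_fun_unique[OF assms(1) _ _ _ f(1-3)] by blast
  qed (use f(1-3) in blast)
  thus ?thesis using f(4) assms(6) by blast
qed

section \<open>The Laurent expansion at the origin\<close>

lemma locally_dominated_cmult:
  assumes "locally_dominated X A f"
  shows "locally_dominated X A (\<lambda>w z. c * f w z)"
  unfolding locally_dominated_def
proof
  fix z0 assume "z0 \<in> A"
  then obtain r K g where *: "r > 0" "finite K" "g summable_on X"
    "\<forall>w\<in>X - K. \<forall>z\<in>cball z0 r. norm (f w z) \<le> g w"
    using assms unfolding locally_dominated_def by blast
  show "\<exists>r>0. \<exists>K g. finite K \<and> g summable_on X \<and> (\<forall>w\<in>X - K. \<forall>z\<in>cball z0 r. norm (c * f w z) \<le> g w)"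
    by (intro exI[of _ r] exI[of _ K] exI[of _ "\<lambda>w. norm c * g w"] conjI summable_on_cmult_right)
       (use * in \<open>auto simp: norm_mult intro!: mult_left_mono\<close>)
qed

lemma locally_dominated_add:
  assumes "locally_dominated X A f" "locally_dominated X A f'"
  shows "locally_dominated X A (\<lambda>w z. f w z + f' w z)"
  unfolding locally_dominated_def
proof
  fix z0 assume z0: "z0 \<in> A"
  obtain r K g where *: "r > 0" "finite K" "g summable_on X"
    "\<forall>w\<in>X - K. \<forall>z\<in>cball z0 r. norm (f w z) \<le> g w"
    using assms(1) z0 unfolding locally_dominated_def by blast
  obtain r' K' g' where **: "r' > 0" "finite K'" "g' summable_on X"
    "\<forall>w\<in>X - K'. \<forall>z\<in>cball z0 r'. norm (f' w z) \<le> g' w"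
    using assms(2) z0 unfolding locally_dominated_def by blast
  have "norm (f w z + f' w z) \<le> g w + g' w" if "w \<in> X - (K \<union> K')" "z \<in> cball z0 (min r r')" for w z
    by (rule order.trans[OF norm_triangle_ineq add_mono]) (use that *(4) **(4) in auto)
  thus "\<exists>r>0. \<exists>K g. finite K \<and> g summable_on X \<and> (\<forall>w\<in>X - K. \<forall>z\<in>cball z0 r. norm (f w z + f' w z) \<le> g w)"
    by (intro exI[of _ "min r r'"] exI[of _ "K \<union> K'"] exI[of _ "\<lambda>w. g w + g' w"] conjI summable_on_add)
       (use * ** in auto)
qed

lemma locally_dominated_sum:
  assumes "finite I" "\<And>i. i \<in> I \<Longrightarrow> locally_dominated X A (f i)"
  shows "locally_dominated X A (\<lambda>w z. \<Sum>i\<in>I. f i w z)"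
  using assms
proof (induction I rule: finite_induct)
  case empty
  show ?case unfolding locally_dominated_def
    by (intro ballI exI[of _ "1::real"] exI[of _ "{}"] exI[of _ "\<lambda>_. 0"] conjI) auto
next
  case (insert i I)
  thus ?case using locally_dominated_add[of X A "f i" "\<lambda>w z. \<Sum>i\<in>I. f i w z"] by simp
qed

lemma locally_dominated_shift:
  assumes "locally_dominated X UNIV f"
  shows "locally_dominated X A (\<lambda>w z. f w (z - a))"
  unfolding locally_dominated_def
proof
  fix z0
  obtain r K g where *: "r > 0" "finite K" "g summable_on X"
    "\<forall>w\<in>X - K. \<forall>z\<in>cball (z0 - a) r. norm (f w z) \<le> g w"
    using assms unfolding locally_dominated_def by blast
  have "z - a \<in> cball (z0 - a) r" if "z \<in> cball z0 r" for z
    using that by (simp add: dist_norm)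
  thus "\<exists>r>0. \<exists>K g. finite K \<and> g summable_on X \<and> (\<forall>w\<in>X - K. \<forall>z\<in>cball z0 r. norm (f w (z - a)) \<le> g w)"
    by (intro exI[of _ r] exI[of _ K] exI[of _ g] conjI ballI) (use * in blast)+
qed

lemma locally_dominated_cong_cofinite:
  assumes "locally_dominated X A f" "finite K0" "\<And>w z. w \<in> X - K0 \<Longrightarrow> f w z = f' w z"
  shows "locally_dominated X A f'"
  unfolding locally_dominated_def
proof
  fix z0 assume "z0 \<in> A"
  then obtain r K g where *: "r > 0" "finite K" "g summable_on X"
    "\<forall>w\<in>X - K. \<forall>z\<in>cball z0 r. norm (f w z) \<le> g w"
    using assms(1) unfolding locally_dominated_def by blast
  have "norm (f' w z) \<le> g w" if "w \<in> X - (K \<union> K0)" "z \<in> cball z0 r" for w z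
  proof -
    have "norm (f w z) \<le> g w" using *(4) that by blast
    thus ?thesis using assms(3)[of w z] that by simp
  qed
  thus "\<exists>r>0. \<exists>K g. finite K \<and> g summable_on X \<and> (\<forall>w\<in>X - K. \<forall>z\<in>cball z0 r. norm (f' w z) \<le> g w)"
    by (intro exI[of _ r] exI[of _ "K \<union> K0"] exI[of _ g] conjI ballI) (use * assms(2) in auto)
qed

text \<open>A geometric series in \<open>z / b\<close>. The exponent \<open>n + 1\<close> at the
  coefficient of \<open>z ^ n\<close> is the index shift between \<open>z^(j-1)\<close> and
  \<open>E_j\<close>.\<close>

lemma has_fps_expansion_simple_pole:
  fixes b :: complex
  assumes "b \<noteq> 0"
  shows "(\<lambda>z. c / (z - b)) has_fps_expansion Abs_fps (\<lambda>n. - c / b ^ (n + 1))"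
proof -
  have "(\<lambda>z. c * inverse (z - b)) has_fps_expansion fps_const c * inverse (fps_X - fps_const b)"
    by (intro fps_expansion_intros) (use assms in auto)
  moreover have "inverse (fps_X - fps_const b) = Abs_fps (\<lambda>n. - 1 / b ^ (n + 1))"
  proof (rule fps_inverse_unique)
    show "(fps_X - fps_const b) * Abs_fps (\<lambda>n. - 1 / b ^ (n + 1)) = 1"
    proof (rule fps_ext)
      fix n show "fps_nth ((fps_X - fps_const b) * Abs_fps (\<lambda>n. - 1 / b ^ (n + 1))) n = fps_nth 1 n"
        using assms by (cases n) (auto simp: left_diff_distrib)
    qed
  qed
  moreover have "fps_const c * Abs_fps (\<lambda>n. - 1 / b ^ (n + 1)) = Abs_fps (\<lambda>n. - c / b ^ (n + 1))"
    by (rule fps_ext) simp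
  ultimately show ?thesis by (simp add: divide_inverse)
qed

text \<open>The divisor version evaluates at one chosen representative of each coset, while
  \<open>m\<close> may have several points over it. Periodicity makes the value constant on each
  fibre, and the sum is regrouped by fibres.\<close>

lemma eisenstein_E_divisor_eq:
  assumes \<tau>: "Im \<tau> > 0" and j: "j \<ge> 1" and lift: "is_lift \<tau> D m"
  shows "eisenstein_E_divisor j \<tau> D =
    (\<Sum>\<alpha>\<in>Poly_Mapping.keys m. of_int (Poly_Mapping.lookup m \<alpha>) * eisenstein_E j \<tau> \<alpha>)"
proof -
  define K where "K = Poly_Mapping.keys m"
  define c where "c = Poly_Mapping.lookup m"
  \<comment> \<open>\<open>T\<close> can be larger than the support of \<open>D\<close>, since the
    multiplicities in a fibre may cancel.\<close>
  define T where "T = to_torus \<tau> ` K"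
  have fin: "finite K" "finite T" by (auto simp: K_def T_def)
  have D: "Poly_Mapping.lookup D P = (\<Sum>\<alpha> | \<alpha> \<in> K \<and> to_torus \<tau> \<alpha> = P. c \<alpha>)" for P
    using lift by (simp add: is_lift_def K_def c_def)
  have "Poly_Mapping.lookup D P = 0" if "P \<notin> T" for P
  proof -
    have "{\<alpha>. \<alpha> \<in> K \<and> to_torus \<tau> \<alpha> = P} = {}" using that by (auto simp: T_def)
    thus ?thesis by (simp only: D sum.empty)
  qed
  hence sub: "Poly_Mapping.keys D \<subseteq> T" by (auto simp: in_keys_iff)
  have E: "eisenstein_E j \<tau> (SOME \<beta>. \<beta> \<in> to_torus \<tau> \<alpha>) = eisenstein_E j \<tau> \<alpha>" for \<alpha>
  proof -
    have "\<alpha> \<in> to_torus \<tau> \<alpha>" by (simp add: to_torus_def lattice_rel_def)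
    hence "(SOME \<beta>. \<beta> \<in> to_torus \<tau> \<alpha>) \<in> to_torus \<tau> \<alpha>" by (rule someI)
    hence "\<alpha> - (SOME \<beta>. \<beta> \<in> to_torus \<tau> \<alpha>) \<in> period_lattice \<tau>"
      by (simp add: to_torus_def lattice_rel_def)
    from eisenstein_E_periodic[OF \<tau> j this, of "SOME \<beta>. \<beta> \<in> to_torus \<tau> \<alpha>"] show ?thesis by simp
  qed
  have "eisenstein_E_divisor j \<tau> D = (\<Sum>P\<in>T. of_int (Poly_Mapping.lookup D P) * eisenstein_E j \<tau> (SOME \<alpha>. \<alpha> \<in> P))"
    unfolding eisenstein_E_divisor_def
    by (rule sum.mono_neutral_left[OF fin(2) sub]) (auto simp: in_keys_iff)
  also have "\<dots> = (\<Sum>P\<in>T. \<Sum>\<alpha> | \<alpha> \<in> K \<and> to_torus \<tau> \<alpha> = P. of_int (c \<alpha>) * eisenstein_E j \<tau> \<alpha>)"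
  proof (rule sum.cong)
    fix P
    have "of_int (Poly_Mapping.lookup D P) * eisenstein_E j \<tau> (SOME \<alpha>. \<alpha> \<in> P) =
        (\<Sum>\<alpha> | \<alpha> \<in> K \<and> to_torus \<tau> \<alpha> = P. of_int (c \<alpha>) * eisenstein_E j \<tau> (SOME \<alpha>. \<alpha> \<in> P))"
      by (simp add: D sum_distrib_right)
    also have "\<dots> = (\<Sum>\<alpha> | \<alpha> \<in> K \<and> to_torus \<tau> \<alpha> = P. of_int (c \<alpha>) * eisenstein_E j \<tau> \<alpha>)"
      by (rule sum.cong) (use E in auto)
    finally show "of_int (Poly_Mapping.lookup D P) * eisenstein_E j \<tau> (SOME \<alpha>. \<alpha> \<in> P) =
        (\<Sum>\<alpha> | \<alpha> \<in> K \<and> to_torus \<tau> \<alpha> = P. of_int (c \<alpha>) * eisenstein_E j \<tau> \<alpha>)" .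
  qed simp
  also have "\<dots> = (\<Sum>\<alpha>\<in>K. of_int (c \<alpha>) * eisenstein_E j \<tau> \<alpha>)"
    by (rule sum.group) (use fin in \<open>auto simp: T_def\<close>)
  finally show ?thesis by (simp add: K_def c_def)
qed

text \<open>As 0 is the only lattice point allowed in \<open>K\<close>, the only fraction singular
  at the origin belongs to \<open>\<alpha> = \<omega> = 0\<close>. Without it the lattice sum is
  holomorphic near 0; termwise differentiation and \<open>sum_eisenstein_E\<close> give its
  coefficients.\<close>

lemma balanced_zeta_laurent:
  fixes c :: "complex \<Rightarrow> int"
  assumes \<tau>: "Im \<tau> > 0" and K: "finite K" and c0: "(\<Sum>\<alpha>\<in>K. c \<alpha>) = 0" and c1: "(\<Sum>\<alpha>\<in>K. of_int (c \<alpha>) * \<alpha>) = 0"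
    and K0: "\<And>\<alpha>. \<alpha> \<in> K \<Longrightarrow> \<alpha> \<in> period_lattice \<tau> \<Longrightarrow> \<alpha> = 0"
  shows "(\<lambda>z. \<Sum>\<alpha>\<in>K. of_int (c \<alpha>) * weierstrass_zeta \<tau> (z - \<alpha>)) has_laurent_expansion
    fls_const (of_int (\<Sum>\<alpha>\<in>K \<inter> {0}. c \<alpha>)) * fls_X_inv -
    fps_to_fls (Abs_fps (\<lambda>n. \<Sum>\<alpha>\<in>K. of_int (c \<alpha>) * eisenstein_E (n + 1) \<tau> \<alpha>))"
proof -
  let ?L = "period_lattice \<tau>"
  define d where "d = (of_int (\<Sum>\<alpha>\<in>K \<inter> {0}. c \<alpha>) :: complex)"
  have c0': "(\<Sum>\<alpha>\<in>K. complex_of_int (c \<alpha>)) = 0" using c0 by (simp flip: of_int_sum)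
  have c2: "(\<Sum>\<alpha>\<in>K. of_int (c \<alpha>) * cnj \<alpha>) = 0"
    using arg_cong[OF c1, of cnj] by simp
  \<comment> \<open>The plain fractions with a possible pole at the origin left out;
    \<open>d\<close> below restores it as the principal part.\<close>
  define h where "h = (\<lambda>\<omega> z. \<Sum>\<alpha>\<in>K. if \<alpha> + \<omega> = 0 then 0 else of_int (c \<alpha>) / (z - (\<alpha> + \<omega>)))"
  define H where "H = (\<lambda>z. \<Sum>\<^sub>\<infinity>\<omega>\<in>?L. h \<omega> z)"
  have zero_iff: "\<alpha> + \<omega> = 0 \<longleftrightarrow> \<alpha> = 0 \<and> \<omega> = 0" if "\<alpha> \<in> K" "\<omega> \<in> ?L" for \<alpha> \<omega>
    using K0[OF that(1)] period_lattice_uminus[OF that(2)] by (auto simp: add_eq_0_iff2)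
  have "eventually (\<lambda>w. \<forall>\<alpha>\<in>K. w - \<alpha> \<notin> ?L) (at 0)"
    using K eventually_at_notin_shifted_lattice[OF \<tau>] by (simp add: eventually_ball_finite)
  \<comment> \<open>All poles \<open>\<alpha> + \<omega>\<close> other than 0 lie outside the disc
    of radius \<open>r\<close>.\<close>
  then obtain r where r: "r > 0" "\<And>w \<alpha>. w \<noteq> 0 \<Longrightarrow> cmod w < r \<Longrightarrow> \<alpha> \<in> K \<Longrightarrow> w - \<alpha> \<notin> ?L"
    unfolding eventually_at by auto
  \<comment> \<open>For \<open>\<omega> \<noteq> 0\<close> the balanced zeta terms coincide with
    \<open>h\<close>, so their domination carries over; the remaining index 0 joins the finite
    exception set.\<close>
  have dom: "locally_dominated ?L (ball 0 r) h"
  proof (rule locally_dominated_cong_cofinite)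
    show "locally_dominated ?L (ball 0 r) (\<lambda>\<omega> z. \<Sum>\<alpha>\<in>K. of_int (c \<alpha>) * zeta_term \<omega> (z - \<alpha>))"
      by (intro locally_dominated_sum K locally_dominated_cmult locally_dominated_shift
            zeta_term_locally_dominated \<tau>)
    show "finite {0::complex}" by simp
    fix \<omega> z assume w: "\<omega> \<in> ?L - {0}"
    have "(\<Sum>\<alpha>\<in>K. of_int (c \<alpha>) * zeta_term \<omega> (z - \<alpha>)) =
        (\<Sum>\<alpha>\<in>K. of_int (c \<alpha>) / (z - (\<alpha> + \<omega>))) + (\<Sum>\<alpha>\<in>K. of_int (c \<alpha>)) / \<omega> +
        ((\<Sum>\<alpha>\<in>K. of_int (c \<alpha>)) * z - (\<Sum>\<alpha>\<in>K. of_int (c \<alpha>) * \<alpha>)) / \<omega>\<^sup>2"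
      by (simp add: zeta_term_def ring_distribs sum.distrib sum_divide_distrib sum_distrib_right
            diff_divide_distrib sum_subtractf diff_diff_eq)
    also have "\<dots> = (\<Sum>\<alpha>\<in>K. of_int (c \<alpha>) / (z - (\<alpha> + \<omega>)))" by (simp add: c0' c1)
    also have "\<dots> = h \<omega> z" unfolding h_def using w zero_iff by (intro sum.cong) auto
    finally show "(\<Sum>\<alpha>\<in>K. of_int (c \<alpha>) * zeta_term \<omega> (z - \<alpha>)) = h \<omega> z" .
  qed
  have holo: "h \<omega> holomorphic_on ball 0 r" if w: "\<omega> \<in> ?L" for \<omega>
    unfolding h_def
  proof (intro holomorphic_on_sum)
    fix \<alpha> assume \<alpha>: "\<alpha> \<in> K"
    show "(\<lambda>z. if \<alpha> + \<omega> = 0 then 0 else of_int (c \<alpha>) / (z - (\<alpha> + \<omega>))) holomorphic_on ball 0 r"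
    proof (cases "\<alpha> + \<omega> = 0")
      case False
      have "z - (\<alpha> + \<omega>) \<noteq> 0" if z: "z \<in> ball 0 r" for z
      proof
        assume *: "z - (\<alpha> + \<omega>) = 0"
        hence "z \<noteq> 0" "z - \<alpha> = \<omega>" using False by (auto simp: algebra_simps)
        thus False using r(2)[of z \<alpha>] z \<alpha> w by simp
      qed
      thus ?thesis using False by (auto intro!: holomorphic_intros)
    qed (simp add: holomorphic_on_const)
  qed
  have h_fps: "h \<omega> has_fps_expansion (\<Sum>\<alpha>\<in>K. Abs_fps (\<lambda>n. - of_int (c \<alpha>) / (\<alpha> + \<omega>) ^ (n + 1)))" for \<omega>
    unfolding h_def
  proof (rule has_fps_expansion_sum)
    fix \<alpha>
    show "(\<lambda>z. if \<alpha> + \<omega> = 0 then 0 else of_int (c \<alpha>) / (z - (\<alpha> + \<omega>))) has_fps_expansion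
            Abs_fps (\<lambda>n. - of_int (c \<alpha>) / (\<alpha> + \<omega>) ^ (n + 1))"
    proof (cases "\<alpha> + \<omega> = 0")
      \<comment> \<open>Since \<open>0 ^ (n + 1) = 0\<close>, division by 0 makes these coefficients
        vanish. This matches both the fraction left out of \<open>h\<close> and the term omitted
        from the Eisenstein series.\<close>
      case True
      hence "Abs_fps (\<lambda>n. - complex_of_int (c \<alpha>) / (\<alpha> + \<omega>) ^ (n + 1)) = 0"
        by (intro fps_ext) simp
      thus ?thesis using True by simp
    qed (use has_fps_expansion_simple_pole[of "\<alpha> + \<omega>" "of_int (c \<alpha>)"] in simp)
  qed
  have H_fps: "H has_fps_expansion fps_expansion H 0"
    unfolding H_def
    by (rule has_fps_expansion_fps_expansion[OF open_ball[of 0 r]])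
       (use r(1) locally_dominated_holomorphic[OF dom open_ball holo] in auto)
  have "fps_nth (fps_expansion H 0) n = - (\<Sum>\<alpha>\<in>K. of_int (c \<alpha>) * eisenstein_E (n + 1) \<tau> \<alpha>)" for n
  proof -
    have "((\<lambda>\<omega>. (deriv ^^ n) (h \<omega>) 0) has_sum (deriv ^^ n) H 0) ?L"
      unfolding H_def by (rule locally_dominated_higher_deriv[OF dom open_ball holo]) (use r(1) in auto)
    hence "((\<lambda>\<omega>. (1 / fact n) * (deriv ^^ n) (h \<omega>) 0) has_sum (1 / fact n) * (deriv ^^ n) H 0) ?L"
      by (rule has_sum_cmult_right)
    moreover have "(1 / fact n) * (deriv ^^ n) (h \<omega>) 0 = - (\<Sum>\<alpha>\<in>K. of_int (c \<alpha>) / (\<alpha> + \<omega>) ^ (n + 1))" for \<omega>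
      using fps_nth_fps_expansion[OF h_fps[of \<omega>], of n] by (simp add: fps_sum_nth sum_negf)
    ultimately have "((\<lambda>\<omega>. - (\<Sum>\<alpha>\<in>K. of_int (c \<alpha>) / (\<alpha> + \<omega>) ^ (n + 1))) has_sum fps_nth (fps_expansion H 0) n) ?L"
      using fps_nth_fps_expansion[OF H_fps, of n] by simp
    hence "fps_nth (fps_expansion H 0) n = (\<Sum>\<^sub>\<infinity>\<omega>\<in>?L. - (\<Sum>\<alpha>\<in>K. of_int (c \<alpha>) / (\<alpha> + \<omega>) ^ (n + 1)))"
      by (simp add: infsumI)
    also have "\<dots> = - (\<Sum>\<alpha>\<in>K. of_int (c \<alpha>) * eisenstein_E (n + 1) \<tau> \<alpha>)"
      unfolding infsum_uminus using sum_eisenstein_E[OF \<tau> _ K c0' c1 c2, of "n + 1"] by simp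
    finally show ?thesis .
  qed
  hence H_eq: "fps_expansion H 0 = - Abs_fps (\<lambda>n. \<Sum>\<alpha>\<in>K. of_int (c \<alpha>) * eisenstein_E (n + 1) \<tau> \<alpha>)"
    by (intro fps_ext) simp
  have "(\<lambda>z. d * inverse z + H z) has_laurent_expansion fls_const d * fls_X_inv + fps_to_fls (fps_expansion H 0)"
    by (intro laurent_expansion_intros has_laurent_expansion_fps H_fps)
  also have "fls_const d * fls_X_inv + fps_to_fls (fps_expansion H 0) = fls_const d * fls_X_inv -
      fps_to_fls (Abs_fps (\<lambda>n. \<Sum>\<alpha>\<in>K. of_int (c \<alpha>) * eisenstein_E (n + 1) \<tau> \<alpha>))"
    unfolding H_eq by simp
  also have "(\<lambda>z. d * inverse z + H z) has_laurent_expansion \<dots> \<longleftrightarrow> ?thesis"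
  proof (rule has_laurent_expansion_cong)
    have "d * inverse z + H z = (\<Sum>\<alpha>\<in>K. of_int (c \<alpha>) * weierstrass_zeta \<tau> (z - \<alpha>))" if z: "z \<in> ball 0 r" for z
    proof -
      have balanced: "((\<lambda>\<omega>. \<Sum>\<alpha>\<in>K. of_int (c \<alpha>) / (z - \<alpha> - \<omega>)) has_sum
              (\<Sum>\<alpha>\<in>K. of_int (c \<alpha>) * weierstrass_zeta \<tau> (z - \<alpha>))) ?L"
        by (rule has_sum_balanced_zeta[OF \<tau> K c0'])
           (simp add: c1 right_diff_distrib sum_subtractf sum_distrib_right[symmetric] c0')
      \<comment> \<open>The principal part is attached to the summand \<open>\<omega> = 0\<close>,
        after which both sides are the same lattice sum.\<close>
      have "((\<lambda>\<omega>. (if \<omega> = 0 then d * inverse z else 0) + h \<omega> z) has_sum (d * inverse z + H z)) ?L"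
      proof (rule has_sum_add)
        have "((\<lambda>\<omega>. if \<omega> = 0 then d * inverse z else 0) has_sum d * inverse z) {0::complex}"
          using has_sum_finite[of "{0::complex}" "\<lambda>\<omega>. if \<omega> = 0 then d * inverse z else 0"] by simp
        thus "((\<lambda>\<omega>. if \<omega> = 0 then d * inverse z else 0) has_sum d * inverse z) ?L"
          by (rule has_sum_cong_neutral[THEN iffD1, rotated -1]) auto
        show "((\<lambda>\<omega>. h \<omega> z) has_sum H z) ?L"
          unfolding H_def by (intro has_sum_infsum locally_dominated_summable[OF dom z])
      qed
      moreover have "(if \<omega> = 0 then d * inverse z else 0) + h \<omega> z = (\<Sum>\<alpha>\<in>K. of_int (c \<alpha>) / (z - \<alpha> - \<omega>))"
        if w: "\<omega> \<in> ?L" for \<omega>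
      proof (cases "\<omega> = 0")
        case False
        thus ?thesis unfolding h_def using w zero_iff by (auto intro!: sum.cong simp: diff_diff_eq)
      next
        case True
        have "(\<Sum>\<alpha>\<in>K. of_int (c \<alpha>) / (z - \<alpha>)) =
            (\<Sum>\<alpha>\<in>K. (if \<alpha> \<in> {0} then of_int (c \<alpha>) * inverse z else 0) + (if \<alpha> = 0 then 0 else of_int (c \<alpha>) / (z - \<alpha>)))"
          by (rule sum.cong) (auto simp: divide_inverse)
        also have "\<dots> = (\<Sum>\<alpha>\<in>K \<inter> {0}. of_int (c \<alpha>) * inverse z) + h 0 z"
          unfolding sum.distrib h_def sum.inter_restrict[OF K] by (simp cong: if_cong)
        also have "(\<Sum>\<alpha>\<in>K \<inter> {0}. of_int (c \<alpha>) * inverse z) = d * inverse z"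
          by (simp add: d_def sum_distrib_right)
        finally show ?thesis using True by simp
      qed
      ultimately have "((\<lambda>\<omega>. \<Sum>\<alpha>\<in>K. of_int (c \<alpha>) / (z - \<alpha> - \<omega>)) has_sum (d * inverse z + H z)) ?L"
        by (simp cong: has_sum_cong)
      thus ?thesis using balanced by (rule has_sum_unique)
    qed
    thus "\<forall>\<^sub>F z in at 0. d * inverse z + H z = (\<Sum>\<alpha>\<in>K. of_int (c \<alpha>) * weierstrass_zeta \<tau> (z - \<alpha>))"
      unfolding eventually_at using r(1) by (intro exI[of _ r]) auto
  qed (simp add: d_def)
  finally show ?thesis .
qed

theorem theorem2p8:
  fixes \<tau> :: complex and D :: "complex set \<Rightarrow>\<^sub>0 int" and m :: "complex \<Rightarrow>\<^sub>0 int"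
  assumes "Im \<tau> > 0"
    and "principal_divisor \<tau> D"
    and "principal_lift \<tau> D m"
    and "\<forall>\<alpha>\<in>Poly_Mapping.keys m. \<alpha> \<in> period_lattice \<tau> \<longrightarrow> \<alpha> = 0"
  shows "(\<forall>z. (\<forall>\<alpha>\<in>Poly_Mapping.keys m. z - \<alpha> \<notin> period_lattice \<tau>) \<longrightarrow>
            deriv (elliptic_fun_of_divisor \<tau> D) z / elliptic_fun_of_divisor \<tau> D z =
              (\<Sum>\<alpha>\<in>Poly_Mapping.keys m.
                 of_int (Poly_Mapping.lookup m \<alpha>) * weierstrass_zeta \<tau> (z - \<alpha>)) \<and>
            (\<lambda>\<omega>. norm (\<Sum>\<alpha>\<in>Poly_Mapping.keys m.
                 of_int (Poly_Mapping.lookup m \<alpha>) / (z - \<alpha> - \<omega>))) summable_on period_lattice \<tau> \<and>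
            (\<Sum>\<alpha>\<in>Poly_Mapping.keys m.
                 of_int (Poly_Mapping.lookup m \<alpha>) * weierstrass_zeta \<tau> (z - \<alpha>)) =
              (\<Sum>\<^sub>\<infinity>\<omega>\<in>period_lattice \<tau>. \<Sum>\<alpha>\<in>Poly_Mapping.keys m.
                 of_int (Poly_Mapping.lookup m \<alpha>) / (z - \<alpha> - \<omega>))) \<and>
         (\<forall>l\<ge>1. Poly_Mapping.keys D \<subseteq> torus_torsion \<tau> l \<longrightarrow>
            (\<lambda>z. deriv (elliptic_fun_of_divisor \<tau> D) z / elliptic_fun_of_divisor \<tau> D z)
              has_laurent_expansion
              (fls_const (of_int (mult_at_origin \<tau> D)) * fls_X_inv
                - fps_to_fls (Abs_fps (\<lambda>n. eisenstein_E_divisor (n + 1) \<tau> D))))"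
proof (intro conjI allI impI)
  define K where "K = Poly_Mapping.keys m"
  define c where "c = Poly_Mapping.lookup m"
  have D: "is_divisor \<tau> D" using assms(2) by (simp add: principal_divisor_def)
  have lift: "is_lift \<tau> D m" "lift_degree m = 0" "lift_sum m = 0"
    using assms(3) by (auto simp: principal_lift_def)
  have K: "finite K" by (simp add: K_def)
  have c0: "(\<Sum>\<alpha>\<in>K. c \<alpha>) = 0" using lift(2) by (simp add: lift_degree_def K_def c_def)
  have c0': "(\<Sum>\<alpha>\<in>K. complex_of_int (c \<alpha>)) = 0" using c0 by (simp flip: of_int_sum)
  have c1: "(\<Sum>\<alpha>\<in>K. of_int (c \<alpha>) * \<alpha>) = 0" using lift(3) by (simp add: lift_sum_def K_def c_def)
  have c2: "(\<Sum>\<alpha>\<in>K. of_int (c \<alpha>) * cnj \<alpha>) = 0" using arg_cong[OF c1, of cnj] by simp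
  note logderiv = elliptic_fun_of_divisor_logderiv[OF assms(1) D lift]
  {
    fix z assume z: "\<forall>\<alpha>\<in>Poly_Mapping.keys m. z - \<alpha> \<notin> period_lattice \<tau>"
    show "deriv (elliptic_fun_of_divisor \<tau> D) z / elliptic_fun_of_divisor \<tau> D z =
        (\<Sum>\<alpha>\<in>Poly_Mapping.keys m. of_int (Poly_Mapping.lookup m \<alpha>) * weierstrass_zeta \<tau> (z - \<alpha>))"
      by (rule logderiv) (use z in auto)
    \<comment> \<open>Since the multiplicities add up to 0, the points \<open>z - \<alpha>\<close>
      are again balanced, for every \<open>z\<close>. The sign of \<omega> is then changed by the
      symmetry of the lattice.\<close>
    have "(\<lambda>\<omega>. norm (\<Sum>\<alpha>\<in>K. of_int (c \<alpha>) / ((z - \<alpha>) + \<omega>) ^ 1)) summable_on period_lattice \<tau>"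
      by (rule abs_summable_balanced[OF assms(1) _ K c0'])
         (simp_all add: right_diff_distrib sum_subtractf sum_distrib_right[symmetric] c0' c1 c2)
    thus "(\<lambda>\<omega>. norm (\<Sum>\<alpha>\<in>Poly_Mapping.keys m. of_int (Poly_Mapping.lookup m \<alpha>) / (z - \<alpha> - \<omega>)))
        summable_on period_lattice \<tau>"
      using summable_on_period_lattice_uminus[of "\<lambda>\<omega>. norm (\<Sum>\<alpha>\<in>K. of_int (c \<alpha>) / ((z - \<alpha>) + \<omega>))" \<tau>]
      by (simp add: K_def c_def)
    have "((\<lambda>\<omega>. \<Sum>\<alpha>\<in>K. of_int (c \<alpha>) / (z - \<alpha> - \<omega>)) has_sum
        (\<Sum>\<alpha>\<in>K. of_int (c \<alpha>) * weierstrass_zeta \<tau> (z - \<alpha>))) (period_lattice \<tau>)"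
      by (rule has_sum_balanced_zeta[OF assms(1) K c0'])
         (simp add: right_diff_distrib sum_subtractf sum_distrib_right[symmetric] c0' c1)
    thus "(\<Sum>\<alpha>\<in>Poly_Mapping.keys m. of_int (Poly_Mapping.lookup m \<alpha>) * weierstrass_zeta \<tau> (z - \<alpha>)) =
        (\<Sum>\<^sub>\<infinity>\<omega>\<in>period_lattice \<tau>. \<Sum>\<alpha>\<in>Poly_Mapping.keys m. of_int (Poly_Mapping.lookup m \<alpha>) / (z - \<alpha> - \<omega>))"
      by (simp add: infsumI K_def c_def)
  }
  have K0: "\<alpha> = 0" if "\<alpha> \<in> K" "\<alpha> \<in> period_lattice \<tau>" for \<alpha>
    using assms(4) that by (simp add: K_def)
  \<comment> \<open>The hypothesis on lattice points in the lift leaves at most the point 0 over the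
    origin of the torus, so its multiplicity is that of \<open>D\<close> there.\<close>
  have "{\<alpha>. \<alpha> \<in> K \<and> to_torus \<tau> \<alpha> = to_torus \<tau> 0} = K \<inter> {0}"
    using K0 by (auto simp: to_torus_eq_iff)
  hence m0: "mult_at_origin \<tau> D = (\<Sum>\<alpha>\<in>K \<inter> {0}. c \<alpha>)"
    using lift(1) by (simp add: mult_at_origin_def is_lift_def K_def c_def)
  have E: "eisenstein_E_divisor (n + 1) \<tau> D = (\<Sum>\<alpha>\<in>K. of_int (c \<alpha>) * eisenstein_E (n + 1) \<tau> \<alpha>)" for n
    using eisenstein_E_divisor_eq[OF assms(1) _ lift(1), of "n + 1"] by (simp add: K_def c_def)
  \<comment> \<open>The formula for the logarithmic derivative holds off the translates of the
    lattice by the points of \<open>K\<close>; these miss a punctured neighbourhood of 0, which is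
    enough for a Laurent expansion.\<close>
  have "eventually (\<lambda>w. \<forall>\<alpha>\<in>K. w - \<alpha> \<notin> period_lattice \<tau>) (at 0)"
    using K eventually_at_notin_shifted_lattice[OF assms(1)] by (simp add: eventually_ball_finite)
  hence ev: "eventually (\<lambda>z. (\<Sum>\<alpha>\<in>K. of_int (c \<alpha>) * weierstrass_zeta \<tau> (z - \<alpha>)) =
      deriv (elliptic_fun_of_divisor \<tau> D) z / elliptic_fun_of_divisor \<tau> D z) (at 0)"
    by eventually_elim (use logderiv in \<open>auto simp: K_def c_def\<close>)
  show "(\<lambda>z. deriv (elliptic_fun_of_divisor \<tau> D) z / elliptic_fun_of_divisor \<tau> D z) has_laurent_expansion
      fls_const (of_int (mult_at_origin \<tau> D)) * fls_X_inv
        - fps_to_fls (Abs_fps (\<lambda>n. eisenstein_E_divisor (n + 1) \<tau> D))"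
    unfolding m0 E
    using balanced_zeta_laurent[OF assms(1) K c0 c1 K0] has_laurent_expansion_cong[OF ev refl] by blast
qed

end
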